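(* Let $M_1,M_2$ be matroids of positive rank on disjoint ground sets, such that no matroid isomorphic to $M_1$ can be obtained from $M_2$ by any combination of minors, free extensions and free coextensions, and no matroid isomorphic to $M_2$ can be obtained from $M_1$ in this way. Assume neither $M_1$ nor $M_2$ has a circuit-hyperplane. Then for each integer $n$ there is an integer $k_0$ such that for every $k\ge k_0$, $M_1$ and $M_2$ have at least $n$ pairwise nonisomorphic intertwines of rank $k$.
   Context: All matroids are finite. The free extension $N+x$ of $N$ by a new element $x$ has as circuits the circuits of $N$ together with $B\cup x$ for bases $B$ of $N$; the free coextension is $N\times x=(N^*+x)^*$. A circuit-hyperplane is a set that is both a circuit and a hyperplane. A matroid $M$ is an intertwine of $N_1$ and $N_2$ if $M$ has minors isomorphic to $N_1$ and to $N_2$, but no proper minor of $M$ has both. *)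

theory Defs
  imports Main "HOL-Library.Infinite_Typeclass"
begin

record 'a indep_system =
  ground :: "'a set"
  indep :: "'a set set"

locale matroid =
  fixes M :: "'a indep_system"
  assumes finite_ground: "finite (ground M)"
    and indep_subset: "I \<in> indep M \<Longrightarrow> I \<subseteq> ground M"
    and indep_empty: "{} \<in> indep M"
    and indep_mono: "J \<in> indep M \<Longrightarrow> I \<subseteq> J \<Longrightarrow> I \<in> indep M"
    and indep_augment: "I \<in> indep M \<Longrightarrow> J \<in> indep M \<Longrightarrow> card I < card J \<Longrightarrow>
          \<exists>x \<in> J - I. insert x I \<in> indep M"

definition bases :: "'a indep_system \<Rightarrow> 'a set set" where
  "bases M = {B \<in> indep M. \<forall>I \<in> indep M. B \<subseteq> I \<longrightarrow> I = B}"

definition circuits :: "'a indep_system \<Rightarrow> 'a set set" where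
  "circuits M = {C. C \<subseteq> ground M \<and> C \<notin> indep M \<and> (\<forall>D. D \<subset> C \<longrightarrow> D \<in> indep M)}"

definition rank_of :: "'a indep_system \<Rightarrow> 'a set \<Rightarrow> nat" where
  "rank_of M X = Max (card ` {I \<in> indep M. I \<subseteq> X})"

definition rank :: "'a indep_system \<Rightarrow> nat" where
  "rank M = rank_of M (ground M)"

definition flats :: "'a indep_system \<Rightarrow> 'a set set" where
  "flats M = {F. F \<subseteq> ground M \<and> (\<forall>e \<in> ground M - F. rank_of M F < rank_of M (insert e F))}"

definition hyperplanes :: "'a indep_system \<Rightarrow> 'a set set" where
  "hyperplanes M = {H \<in> flats M. Suc (rank_of M H) = rank M}"

definition circuit_hyperplanes :: "'a indep_system \<Rightarrow> 'a set set" where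
  "circuit_hyperplanes M = circuits M \<inter> hyperplanes M"

definition isomorphic :: "'a indep_system \<Rightarrow> 'b indep_system \<Rightarrow> bool" where
  "isomorphic M N \<longleftrightarrow> (\<exists>f. bij_betw f (ground M) (ground N) \<and>
     (\<forall>I. I \<subseteq> ground M \<longrightarrow> (I \<in> indep M \<longleftrightarrow> f ` I \<in> indep N)))"

definition dual :: "'a indep_system \<Rightarrow> 'a indep_system" where
  "dual M = \<lparr>ground = ground M,
             indep = {I. I \<subseteq> ground M \<and> (\<exists>B \<in> bases M. I \<inter> B = {})}\<rparr>"

definition delete :: "'a indep_system \<Rightarrow> 'a set \<Rightarrow> 'a indep_system" where
  "delete M X = \<lparr>ground = ground M - X, indep = {I \<in> indep M. I \<inter> X = {}}\<rparr>"

definition contract :: "'a indep_system \<Rightarrow> 'a set \<Rightarrow> 'a indep_system" where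
  "contract M X = dual (delete (dual M) X)"

definition is_minor :: "'a indep_system \<Rightarrow> 'a indep_system \<Rightarrow> bool" where
  "is_minor N M \<longleftrightarrow> (\<exists>X Y. X \<subseteq> ground M \<and> Y \<subseteq> ground M \<and> X \<inter> Y = {} \<and>
     N = delete (contract M X) Y)"

definition is_proper_minor :: "'a indep_system \<Rightarrow> 'a indep_system \<Rightarrow> bool" where
  "is_proper_minor N M \<longleftrightarrow> is_minor N M \<and> ground N \<noteq> ground M"

definition has_minor_iso :: "'a indep_system \<Rightarrow> 'b indep_system \<Rightarrow> bool" where
  "has_minor_iso M N \<longleftrightarrow> (\<exists>N'. is_minor N' M \<and> isomorphic N' N)"

definition of_circuits :: "'a set \<Rightarrow> 'a set set \<Rightarrow> 'a indep_system" where
  "of_circuits E \<C> = \<lparr>ground = E, indep = {I. I \<subseteq> E \<and> (\<forall>C \<in> \<C>. \<not> C \<subseteq> I)}\<rparr>"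

text \<open>The operations below are meaningful only for \<open>x\<close> outside the ground set.\<close>

definition free_extension :: "'a indep_system \<Rightarrow> 'a \<Rightarrow> 'a indep_system" where
  "free_extension N x =
     of_circuits (insert x (ground N)) (circuits N \<union> {insert x B | B. B \<in> bases N})"

definition free_coextension :: "'a indep_system \<Rightarrow> 'a \<Rightarrow> 'a indep_system" where
  "free_coextension N x = dual (free_extension (dual N) x)"

text \<open>The independent sets of \<^const>\<open>of_circuits\<close> are those containing no listed set; the listed
  family is really the family of circuits of a free extension:\<close>

lemma (in matroid) circuits_free_extension:
  assumes x: "x \<notin> ground M"
  shows "circuits (free_extension M x) = circuits M \<union> {insert x B | B. B \<in> bases M}"
proof -
  define \<C> where "\<C> = circuits M \<union> {insert x B | B. B \<in> bases M}"
  have indep_iff: "I \<in> indep (free_extension M x) \<longleftrightarrow>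
      I \<subseteq> insert x (ground M) \<and> (\<forall>C\<in>\<C>. \<not> C \<subseteq> I)" for I
    by (simp add: free_extension_def of_circuits_def \<C>_def)
  have ground: "ground (free_extension M x) = insert x (ground M)"
    by (simp add: free_extension_def of_circuits_def)
  have c: "A \<subseteq> ground M" "x \<notin> A" "A \<notin> indep M" if "A \<in> circuits M" for A
    using that x by (auto simp: circuits_def)
  have b: "A \<subseteq> ground M" "x \<notin> A" "A \<in> indep M" if "A \<in> bases M" for A
  proof -
    show "A \<in> indep M" using that by (simp add: bases_def)
    then show "A \<subseteq> ground M" by (rule indep_subset)
    then show "x \<notin> A" using x by blast
  qed
  have sub: "C \<subseteq> insert x (ground M)" if "C \<in> \<C>" for C
    using that b(1) c(1) unfolding \<C>_def by fast
  have anti: "C = D" if CD: "C \<in> \<C>" "D \<in> \<C>" "C \<subseteq> D" for C D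
  proof -
    consider "C \<in> circuits M" "D \<in> circuits M"
      | B where "C \<in> circuits M" "B \<in> bases M" "D = insert x B"
      | B where "B \<in> bases M" "C = insert x B" "D \<in> circuits M"
      | B B' where "B \<in> bases M" "C = insert x B" "B' \<in> bases M" "D = insert x B'"
      using CD unfolding \<C>_def by blast
    then show ?thesis
    proof cases
      case 1
      then show ?thesis using CD(3) by (auto simp: circuits_def)
    next
      case (2 B)
      then have "C \<subseteq> B" using c(2)[of C] CD(3) by blast
      then show ?thesis using indep_mono[OF b(3)] c(3) 2 by metis
    next
      case (3 B)
      then show ?thesis using c(2)[of D] CD(3) by blast
    next
      case (4 B B')
      then have "B \<subseteq> B'" using b(2)[of B] CD(3) by blast
      then show ?thesis using 4 by (auto simp: bases_def)
    qed
  qed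
  have "C \<in> \<C>" if "C \<in> circuits (free_extension M x)" for C
  proof -
    have C: "C \<subseteq> insert x (ground M)" "C \<notin> indep (free_extension M x)"
      using that by (auto simp: circuits_def ground)
    then obtain D where D: "D \<in> \<C>" "D \<subseteq> C" unfolding indep_iff by blast
    then have "D \<notin> indep (free_extension M x)" unfolding indep_iff by blast
    then have "\<not> D \<subset> C" using that by (auto simp: circuits_def)
    then show ?thesis using D by auto
  qed
  moreover have "C \<in> circuits (free_extension M x)" if C: "C \<in> \<C>" for C
  proof -
    have "D \<in> indep (free_extension M x)" if D: "D \<subset> C" for D
    proof -
      have "\<not> A \<subseteq> D" if "A \<in> \<C>" for A
        using anti[OF that C] D by blast
      then show ?thesis using D sub[OF C] unfolding indep_iff by blast
    qed
    moreover have "C \<notin> indep (free_extension M x)" using C unfolding indep_iff by blast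
    ultimately show ?thesis using sub[OF C] by (simp add: circuits_def ground)
  qed
  ultimately show ?thesis unfolding \<C>_def by blast
qed

text \<open>\<open>obtainable M N\<close>: \<open>N\<close> arises from \<open>M\<close> by finitely many operations, in any order, each
  passing to a minor, a free extension or a free coextension. This is the intended notion only over
  an infinite element type, where fresh elements never run out and every finite matroid has a copy.\<close>

inductive obtainable :: "'a indep_system \<Rightarrow> 'a indep_system \<Rightarrow> bool" for M where
  start: "obtainable M M"
| minor: "obtainable M N \<Longrightarrow> is_minor N' N \<Longrightarrow> obtainable M N'"
| ext: "obtainable M N \<Longrightarrow> x \<notin> ground N \<Longrightarrow> obtainable M (free_extension N x)"
| coext: "obtainable M N \<Longrightarrow> x \<notin> ground N \<Longrightarrow> obtainable M (free_coextension N x)"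

definition intertwine :: "'a indep_system \<Rightarrow> 'b indep_system \<Rightarrow> 'c indep_system \<Rightarrow> bool" where
  "intertwine M N\<^sub>1 N\<^sub>2 \<longleftrightarrow> matroid M \<and> has_minor_iso M N\<^sub>1 \<and> has_minor_iso M N\<^sub>2 \<and>
     (\<forall>M'. is_proper_minor M' M \<longrightarrow> \<not> (has_minor_iso M' N\<^sub>1 \<and> has_minor_iso M' N\<^sub>2))"

end

theory Submission
  imports Defs
begin

text \<open>Extend \<open>M\<^sub>1\<close> freely and coextend it freely to a matroid \<open>N\<^sub>1\<close> of rank \<open>k\<close> on a large set \<open>E\<close> containing
  both ground sets, and likewise \<open>M\<^sub>2\<close> to \<open>N\<^sub>2\<close>. If the elements contracted to recover \<open>M\<^sub>1\<close> are, up to a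
  bounded number, those deleted to recover \<open>M\<^sub>2\<close>, and vice versa, then for large \<open>k\<close> every nonbasis of
  \<open>N\<^sub>1\<close> is far, in basis-exchange distance, from every nonbasis of \<open>N\<^sub>2\<close>. Hence the \<open>k\<close>-sets that are
  bases of both are the bases of a matroid, even after removing further \<open>k\<close>-sets \<open>H\<close> that are far from
  all nonbases and from each other. The bases of a minor isomorphic to \<open>M\<^sub>1\<close> come from \<open>k\<close>-sets that are
  close together, so they see only one kind of nonbases: a removed set \<open>H\<close> would make a
  circuit-hyperplane of \<open>M\<^sub>1\<close>, and nonbases of \<open>N\<^sub>2\<close> would make \<open>M\<^sub>1\<close> a minor of \<open>N\<^sub>2\<close>. So the minor is
  a minor of \<open>N\<^sub>1\<close>, and counting nonbases pins down the contracted and deleted elements up to the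
  elements that are cofree, respectively free, in \<open>M\<^sub>1\<close>. Since no element is both, one can arrange
  that no element of \<open>E\<close> is contracted for \<open>M\<^sub>1\<close> as well as for \<open>M\<^sub>2\<close>, nor deleted for both, which is
  minimality. The number of removed sets \<open>H\<close> distinguishes the intertwines.\<close>


section \<open>Rank and bases\<close>

text \<open>Presents a matroid by its bases. This is meant for families of sets of one common size,
  where \<open>bases_spread\<close> recovers the family and basis exchange suffices for
  \<open>matroid_spread\<close>.\<close>

definition spread :: "'a set \<Rightarrow> 'a set set \<Rightarrow> 'a indep_system" where
  "spread E \<B> = \<lparr>ground = E, indep = {I. \<exists>B\<in>\<B>. I \<subseteq> B}\<rparr>"

definition nonbases :: "'a indep_system \<Rightarrow> 'a set set" where
  "nonbases M = {W. W \<subseteq> ground M \<and> card W = rank M \<and> W \<notin> indep M}"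

context matroid
begin

lemma finite_indep: "I \<in> indep M \<Longrightarrow> finite I"
  using indep_subset finite_ground finite_subset by blast

lemma finite_indep_subsets: "finite {I \<in> indep M. I \<subseteq> X}"
  by (rule finite_subset[of _ "Pow (ground M)"]) (auto dest: indep_subset simp: finite_ground)

lemma card_le_rank_of: "I \<in> indep M \<Longrightarrow> I \<subseteq> X \<Longrightarrow> card I \<le> rank_of M X"
  unfolding rank_of_def using finite_indep_subsets by (intro Max_ge) auto

lemma rank_of_witness: obtains I where "I \<in> indep M" "I \<subseteq> X" "card I = rank_of M X"
proof -
  have "rank_of M X \<in> card ` {I \<in> indep M. I \<subseteq> X}"
    unfolding rank_of_def using finite_indep_subsets indep_empty by (intro Max_in) auto
  then show ?thesis using that by auto
qed

lemma rank_of_mono: "X \<subseteq> Y \<Longrightarrow> rank_of M X \<le> rank_of M Y"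
  by (metis rank_of_witness card_le_rank_of subset_trans)

lemma rank_of_le_card: "finite X \<Longrightarrow> rank_of M X \<le> card X"
  by (metis rank_of_witness card_mono)

lemma rank_of_le_rank: "rank_of M X \<le> rank M"
  unfolding rank_def by (metis rank_of_witness card_le_rank_of indep_subset)

lemma rank_of_Un_le: assumes "finite Y" shows "rank_of M (X \<union> Y) \<le> rank_of M X + card Y"
proof -
  obtain I where I: "I \<in> indep M" "I \<subseteq> X \<union> Y" "card I = rank_of M (X \<union> Y)"
    by (rule rank_of_witness)
  have "card I \<le> card (I \<inter> X) + card (I \<inter> Y)"
    using I(2) card_Un_le[of "I \<inter> X" "I \<inter> Y"] by (simp add: Int_Un_distrib[symmetric] Int_absorb2)
  moreover have "card (I \<inter> X) \<le> rank_of M X"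
    using I indep_mono by (intro card_le_rank_of) auto
  moreover have "card (I \<inter> Y) \<le> card Y" using assms by (simp add: card_mono)
  ultimately show ?thesis using I by linarith
qed

lemma rank_of_insert_le: "rank_of M (insert x X) \<le> Suc (rank_of M X)"
  using rank_of_Un_le[of "{x}" X] by simp

lemma indep_iff_rank_of: "finite X \<Longrightarrow> X \<in> indep M \<longleftrightarrow> rank_of M X = card X"
  by (metis rank_of_witness card_le_rank_of card_subset_eq rank_of_le_card subset_refl le_antisym)

lemma dep_iff_rank_of: "finite X \<Longrightarrow> X \<notin> indep M \<longleftrightarrow> rank_of M X < card X"
  using indep_iff_rank_of rank_of_le_card by (metis le_neq_implies_less less_irrefl)

lemma card_le_rank: "I \<in> indep M \<Longrightarrow> card I \<le> rank M"
  unfolding rank_def by (simp add: card_le_rank_of indep_subset)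

lemma augment_within:
  assumes "I \<in> indep M" "J \<in> indep M" "card I \<le> m" "m \<le> card J"
  shows "\<exists>K \<in> indep M. I \<subseteq> K \<and> K \<subseteq> I \<union> J \<and> card K = m"
  using assms(3,4)
proof (induction m rule: dec_induct)
  case base then show ?case using assms by auto
next
  case (step n)
  then obtain K where K: "K \<in> indep M" "I \<subseteq> K" "K \<subseteq> I \<union> J" "card K = n" by auto
  obtain x where "x \<in> J - K" "insert x K \<in> indep M"
    using indep_augment[OF K(1) assms(2)] step K(4) by auto
  then show ?case using K finite_indep[of K] by (intro bexI[of _ "insert x K"]) auto
qed

lemma bases_iff: "B \<in> bases M \<longleftrightarrow> B \<in> indep M \<and> card B = rank M"
proof
  assume B: "B \<in> bases M"
  then have Bi: "B \<in> indep M" by (simp add: bases_def)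
  obtain I where I: "I \<in> indep M" "card I = rank M"
    unfolding rank_def by (metis rank_of_witness)
  obtain K where "K \<in> indep M" "B \<subseteq> K" "card K = rank M"
    using augment_within[OF Bi I(1) card_le_rank[OF Bi]] I by auto
  then show "B \<in> indep M \<and> card B = rank M" using B by (auto simp: bases_def)
next
  assume B: "B \<in> indep M \<and> card B = rank M"
  have "I = B" if "I \<in> indep M" "B \<subseteq> I" for I
    using card_seteq[OF finite_indep[OF that(1)] that(2)] card_le_rank[OF that(1)] B by simp
  then show "B \<in> bases M" using B by (simp add: bases_def)
qed

lemma basis_subset: "B \<in> bases M \<Longrightarrow> B \<subseteq> ground M"
  by (simp add: bases_iff indep_subset)

lemma basis_exists: obtains B where "B \<in> bases M"
  unfolding bases_iff rank_def by (metis rank_of_witness)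

lemma indep_iff_subset_basis: "I \<in> indep M \<longleftrightarrow> (\<exists>B\<in>bases M. I \<subseteq> B)"
proof
  assume I: "I \<in> indep M"
  obtain B where B: "B \<in> bases M" by (rule basis_exists)
  then show "\<exists>B\<in>bases M. I \<subseteq> B"
    using augment_within[OF I, of B "rank M"] card_le_rank[OF I] by (auto simp: bases_iff)
qed (auto simp: bases_iff intro: indep_mono)

lemma basis_exchange:
  assumes "X \<in> bases M" "Y \<in> bases M" "x \<in> X - Y"
  shows "\<exists>y \<in> Y - X. insert y (X - {x}) \<in> bases M"
proof -
  have fin: "finite X" using assms(1) finite_indep by (simp add: bases_iff)
  have "card (X - {x}) < card Y" "X - {x} \<in> indep M"
    using assms fin card_Suc_Diff1[of X x] by (auto simp: bases_iff intro: indep_mono)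
  then obtain y where y: "y \<in> Y - (X - {x})" "insert y (X - {x}) \<in> indep M"
    using indep_augment assms(2) by (metis bases_iff)
  then have "y \<in> Y - X" using assms by auto
  then show ?thesis using y assms fin card_Suc_Diff1[of X x] by (auto simp: bases_iff)
qed

text \<open>Here the incoming element is prescribed and the outgoing one is found. Growing
  \<open>insert x (X \<inter> Y)\<close> inside \<open>insert x X\<close> to the size of a basis
  leaves out exactly one element of \<open>X\<close>, and it lies outside \<open>Y\<close>.\<close>

lemma basis_dual_exchange:
  assumes "X \<in> bases M" "Y \<in> bases M" "x \<in> Y - X"
  shows "\<exists>y \<in> X - Y. insert x (X - {y}) \<in> bases M"
proof -
  have fin: "finite X" "finite Y" using assms finite_indep by (auto simp: bases_iff)
  have I: "insert x (X \<inter> Y) \<in> indep M" using assms by (auto simp: bases_iff intro: indep_mono)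
  have "card (insert x (X \<inter> Y)) \<le> card X"
    using I assms card_le_rank by (simp add: bases_iff)
  then obtain K where K: "K \<in> indep M" "insert x (X \<inter> Y) \<subseteq> K" "K \<subseteq> insert x X" "card K = card X"
    using augment_within[OF I, of X "card X"] assms by (auto simp: bases_iff)
  have "\<not> X \<subseteq> K"
  proof
    assume "X \<subseteq> K"
    then have "X = K" using K fin finite_indep by (intro card_subset_eq) auto
    then show False using K(2) assms(3) by auto
  qed
  then obtain y where y: "y \<in> X" "y \<notin> K" by auto
  have sub: "K \<subseteq> insert x (X - {y})" using K(3) y by auto
  have "card (insert x (X - {y})) = card X" using y fin assms(3) card_Suc_Diff1[of X y] by auto
  then have "K = insert x (X - {y})" using sub K(4) fin by (intro card_subset_eq) auto
  moreover have "y \<in> X - Y" using y K(2) by auto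
  ultimately show ?thesis using K assms(1) by (auto simp: bases_iff)
qed

lemma rank_of_extend:
  assumes "rank_of M X < rank M"
  obtains y where "y \<in> ground M - X" "rank_of M (insert y X) = Suc (rank_of M X)"
proof -
  obtain I where I: "I \<in> indep M" "I \<subseteq> X" "card I = rank_of M X" by (rule rank_of_witness)
  obtain B where B: "B \<in> bases M" by (rule basis_exists)
  then obtain y where y: "y \<in> B - I" "insert y I \<in> indep M"
    using indep_augment[OF I(1), of B] assms I(3) by (auto simp: bases_iff)
  have c: "card (insert y I) = Suc (rank_of M X)" using y I finite_indep by simp
  then have "y \<notin> X" using card_le_rank_of[OF y(2), of X] I(2) by auto
  moreover have "rank_of M (insert y X) = Suc (rank_of M X)"
    using card_le_rank_of[OF y(2), of "insert y X"] c I(2) rank_of_insert_le[of y X] by force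
  ultimately show ?thesis using that y B basis_subset by auto
qed

lemma dep_remove:
  assumes "finite X" "X \<notin> indep M"
  obtains w where "w \<in> X" "rank_of M (X - {w}) = rank_of M X"
proof -
  obtain I where I: "I \<in> indep M" "I \<subseteq> X" "card I = rank_of M X" by (rule rank_of_witness)
  then have "I \<noteq> X" using assms by auto
  then obtain w where w: "w \<in> X" "w \<notin> I" using I by auto
  then have "rank_of M X \<le> rank_of M (X - {w})"
    using card_le_rank_of[OF I(1), of "X - {w}"] I by auto
  then show ?thesis using that w rank_of_mono[of "X - {w}" X] by (simp add: order.antisym)
qed

lemma finite_nonbases: "finite (nonbases M)"
  by (rule finite_subset[of _ "Pow (ground M)"]) (auto simp: nonbases_def finite_ground)

lemma bases_iff_nonbases:
  "W \<subseteq> ground M \<Longrightarrow> card W = rank M \<Longrightarrow> W \<in> bases M \<longleftrightarrow> W \<notin> nonbases M"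
  by (auto simp: bases_iff nonbases_def)

lemma rank_of_nonbasis: "W \<in> nonbases M \<Longrightarrow> rank_of M W < rank M"
  by (metis (mono_tags, lifting) nonbases_def mem_Collect_eq dep_iff_rank_of finite_ground
      finite_subset)

end

section \<open>Matroids given by a family of bases\<close>

lemma spread_simps [simp]: "ground (spread E \<B>) = E" "indep (spread E \<B>) = {I. \<exists>B\<in>\<B>. I \<subseteq> B}"
  by (simp_all add: spread_def)

lemma bases_spread:
  assumes k: "\<And>B. B \<in> \<B> \<Longrightarrow> finite B \<and> card B = k"
  shows "bases (spread E \<B>) = \<B>"
proof -
  have anti: "B = C" if "B \<in> \<B>" "C \<in> \<B>" "B \<subseteq> C" for B C
    using that k card_subset_eq by metis
  show ?thesis
  proof (intro set_eqI iffI)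
    fix B assume "B \<in> bases (spread E \<B>)"
    then obtain C where "C \<in> \<B>" "B \<subseteq> C" "C = B" by (auto simp: bases_def)
    then show "B \<in> \<B>" by simp
  next
    fix B assume B: "B \<in> \<B>"
    have "I = B" if "C \<in> \<B>" "I \<subseteq> C" "B \<subseteq> I" for I C
      using anti[OF B that(1)] that by auto
    then show "B \<in> bases (spread E \<B>)" using B by (auto simp: bases_def)
  qed
qed

text \<open>If \<open>I\<close> cannot be augmented from \<open>J\<close>, exchange forces bases
  \<open>B1\<close> and \<open>B2\<close> containing \<open>I\<close> and \<open>J\<close> to
  satisfy \<open>B2 - B1 = J - I\<close> and \<open>B1 - B2 \<subseteq> I - J\<close>. Both
  differences have the same size, so \<open>J\<close> is no larger than \<open>I\<close>.\<close>

lemma matroid_spread: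
  assumes "finite E" "\<B> \<noteq> {}" and sub: "\<And>B. B \<in> \<B> \<Longrightarrow> B \<subseteq> E" and cd: "\<And>B. B \<in> \<B> \<Longrightarrow> card B = k"
    and exch: "\<And>X Y x. X \<in> \<B> \<Longrightarrow> Y \<in> \<B> \<Longrightarrow> x \<in> X - Y \<Longrightarrow> \<exists>y \<in> Y - X. insert y (X - {x}) \<in> \<B>"
  shows "matroid (spread E \<B>)"
proof
  have fin: "finite B" if "B \<in> \<B>" for B using that sub assms(1) by (meson finite_subset)
  fix I J assume I: "I \<in> indep (spread E \<B>)" and J: "J \<in> indep (spread E \<B>)" and IJ: "card I < card J"
  show "\<exists>x\<in>J - I. insert x I \<in> indep (spread E \<B>)"
  proof (rule ccontr)
    assume "\<not> ?thesis"
    then have no: "\<not> insert x I \<subseteq> B" if "x \<in> J - I" "B \<in> \<B>" for x B using that by auto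
    obtain B1 where B1: "B1 \<in> \<B>" "I \<subseteq> B1" using I by auto
    define \<C> where "\<C> = {B \<in> \<B>. J \<subseteq> B}"
    \<comment> \<open>Minimality of \<open>B2\<close> outside \<open>J \<union> B1\<close> means
      that no exchange towards \<open>B1\<close> can remove a further element there, so
      \<open>B2\<close> lies within \<open>J \<union> B1\<close>.\<close>
    obtain B2 where B2: "B2 \<in> \<C>"
      and min: "\<And>B. B \<in> \<C> \<Longrightarrow> card (B2 - (J \<union> B1)) \<le> card (B - (J \<union> B1))"
      using J arg_min_natI[of "\<lambda>B. B \<in> \<C>" _ "\<lambda>B. card (B - (J \<union> B1))"]
        arg_min_nat_le[of "\<lambda>B. B \<in> \<C>" _ "\<lambda>B. card (B - (J \<union> B1))"]
      unfolding \<C>_def by (auto simp: Bex_def)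
    then have B2': "B2 \<in> \<B>" "J \<subseteq> B2" by (auto simp: \<C>_def)
    have JB1: "J - B1 = J - I" using no B1 by blast
    have "B2 \<subseteq> J \<union> B1"
    proof (rule ccontr)
      assume "\<not> ?thesis"
      then obtain x where x: "x \<in> B2 - (J \<union> B1)" by auto
      then obtain y where y: "y \<in> B1 - B2" "insert y (B2 - {x}) \<in> \<B>" using exch B2'(1) B1(1) by blast
      then have "insert y (B2 - {x}) \<in> \<C>" using x B2' by (auto simp: \<C>_def)
      moreover have "insert y (B2 - {x}) - (J \<union> B1) \<subset> B2 - (J \<union> B1)" using x y by auto
      ultimately show False using min fin[OF B2'(1)]
        by (metis psubset_card_mono finite_Diff not_le)
    qed
    then have e: "B2 - B1 = J - I" using JB1 B2' by auto
    \<comment> \<open>An element of \<open>B1\<close> outside \<open>I \<union> B2\<close> could be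
      exchanged for some \<open>y\<close> in \<open>J - I\<close>, giving a member of the family
      that contains \<open>insert y I\<close>.\<close>
    have "B1 \<subseteq> I \<union> B2"
    proof (rule ccontr)
      assume "\<not> ?thesis"
      then obtain x where x: "x \<in> B1 - (I \<union> B2)" by auto
      then obtain y where y: "y \<in> B2 - B1" "insert y (B1 - {x}) \<in> \<B>" using exch B2'(1) B1(1) by blast
      then show False using no[of y] e x B1 by blast
    qed
    then have e2: "B1 - B2 \<subseteq> I - J" using B2' by auto
    have fIJ: "finite I" "finite J" using B1 B2' fin finite_subset by blast+
    have "card (B1 - B2) + card (B1 \<inter> B2) = card (B2 - B1) + card (B1 \<inter> B2)"
      using card_Int_Diff[OF fin[OF B1(1)], of B2] card_Int_Diff[OF fin[OF B2'(1)], of B1]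
        cd[OF B1(1)] cd[OF B2'(1)] by (simp add: Int_commute)
    then have "card (J - I) \<le> card (I - J)"
      using e e2 fIJ card_mono[OF finite_Diff[OF fIJ(1)] e2] by simp
    then show False using card_Int_Diff[OF fIJ(1), of J] card_Int_Diff[OF fIJ(2), of I] IJ
      by (simp add: Int_commute)
  qed
next
  show "finite (ground (spread E \<B>))" using assms(1) by simp
  show "{} \<in> indep (spread E \<B>)" using assms(2) by auto
  show "I \<subseteq> ground (spread E \<B>)" if "I \<in> indep (spread E \<B>)" for I
    using that sub by fastforce
  show "I \<in> indep (spread E \<B>)" if "J \<in> indep (spread E \<B>)" "I \<subseteq> J" for I J
    using that by auto
qed

section \<open>Duals and minors\<close>

lemma ground_dual [simp]: "ground (dual M) = ground M"
  by (simp add: dual_def)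

lemma ground_delete [simp]: "ground (delete M X) = ground M - X"
  by (simp add: delete_def)

lemma ground_contract [simp]: "ground (contract M X) = ground M - X"
  by (simp add: contract_def)

context matroid
begin

lemma dual_eq_spread: "dual M = spread (ground M) ((-) (ground M) ` bases M)"
  by (rule indep_system.equality) (auto simp: dual_def dest: basis_subset)

lemma card_compl_basis: "B \<in> bases M \<Longrightarrow> card (ground M - B) = card (ground M) - rank M"
  using basis_subset[of B] finite_ground by (simp add: card_Diff_subset finite_subset bases_iff)

lemma matroid_dual: "matroid (dual M)"
  unfolding dual_eq_spread
proof (rule matroid_spread[where k = "card (ground M) - rank M"])
  show "(-) (ground M) ` bases M \<noteq> {}" using basis_exists by blast
  fix X Y x assume "X \<in> (-) (ground M) ` bases M" "Y \<in> (-) (ground M) ` bases M" and x: "x \<in> X - Y"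
  then obtain B C where B: "B \<in> bases M" "X = ground M - B" and C: "C \<in> bases M" "Y = ground M - C"
    by auto
  then have xCB: "x \<in> C - B" using x by auto
  then obtain y where y: "y \<in> B - C" "insert x (B - {y}) \<in> bases M"
    using basis_dual_exchange B(1) C(1) by blast
  have "insert y (X - {x}) = ground M - insert x (B - {y})"
    using y xCB B basis_subset[OF B(1)] by auto
  then show "\<exists>y\<in>Y - X. insert y (X - {x}) \<in> (-) (ground M) ` bases M"
    using y xCB B C basis_subset[OF B(1)] by (intro bexI[of _ y]) auto
qed (auto simp: finite_ground card_compl_basis)

lemma bases_dual: "bases (dual M) = (-) (ground M) ` bases M"
  unfolding dual_eq_spread
  by (rule bases_spread[where k = "card (ground M) - rank M"]) (auto simp: finite_ground card_compl_basis)

lemma compl_mem_bases_dual: "W \<subseteq> ground M \<Longrightarrow> ground M - W \<in> bases (dual M) \<longleftrightarrow> W \<in> bases M"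
proof
  assume "W \<subseteq> ground M" "ground M - W \<in> bases (dual M)"
  then obtain B where "B \<in> bases M" "ground M - W = ground M - B" by (auto simp: bases_dual)
  moreover from this have "W = B" using \<open>W \<subseteq> ground M\<close> basis_subset[of B] by blast
  ultimately show "W \<in> bases M" by simp
qed (simp add: bases_dual)

lemma rank_dual: "rank (dual M) = card (ground M) - rank M"
proof -
  obtain B where "B \<in> bases M" by (rule basis_exists)
  then have "ground M - B \<in> bases (dual M)" "card (ground M - B) = card (ground M) - rank M"
    by (simp_all add: bases_dual card_compl_basis)
  then show ?thesis using matroid.bases_iff[OF matroid_dual, of "ground M - B"] by simp
qed

section \<open>Bases of deletions, contractions and minors\<close>

lemma matroid_delete: "matroid (delete M X)"
proof
  fix I J assume "I \<in> indep (delete M X)" "J \<in> indep (delete M X)" "card I < card J"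
  then show "\<exists>x\<in>J - I. insert x I \<in> indep (delete M X)"
    using indep_augment[of I J] by (auto simp: delete_def)
qed (auto simp: delete_def finite_ground indep_empty dest: indep_subset intro: indep_mono)

text \<open>A single \<open>J\<close> completes all bases of the deletion at once. It is nonempty
  exactly when deleting \<open>X\<close> lowers the rank, so no assumption on \<open>X\<close> is
  needed when minors are composed.\<close>

lemma bases_delete:
  "\<exists>J \<subseteq> X. bases (delete M X) = {Z. Z \<subseteq> ground M - X \<and> Z \<union> J \<in> bases M}"
proof -
  interpret D: matroid "delete M X" by (rule matroid_delete)
  obtain Z0 where Z0: "Z0 \<in> bases (delete M X)" by (rule D.basis_exists)
  then have i0: "Z0 \<in> indep M" "Z0 \<inter> X = {}" "card Z0 = rank (delete M X)"
    by (auto simp: D.bases_iff) (auto simp: delete_def)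
  obtain B0 where B0: "B0 \<in> bases M" "Z0 \<subseteq> B0" using i0 indep_iff_subset_basis by auto
  define J where "J = B0 - Z0"
  have maxi: "insert z Z \<notin> indep M" if "Z \<in> bases (delete M X)" "z \<notin> X" "z \<notin> Z" for z Z
  proof
    assume "insert z Z \<in> indep M"
    then have "insert z Z \<in> indep (delete M X)"
      using that by (auto simp: D.bases_iff) (auto simp: delete_def)
    then show False using D.card_le_rank[of "insert z Z"] that D.finite_indep by (auto simp: D.bases_iff)
  qed
  have JX: "J \<subseteq> X"
  proof
    fix z assume z: "z \<in> J"
    then have "insert z Z0 \<in> indep M" using B0 by (auto simp: J_def bases_iff intro: indep_mono)
    then show "z \<in> X" using maxi[OF Z0, of z] z by (auto simp: J_def)
  qed
  have cJ: "card Z0 + card J = rank M"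
    using B0 finite_indep[of B0] card_mono[of B0 Z0] by (auto simp: J_def bases_iff card_Diff_subset finite_subset)
  have finJ: "finite J" using B0 finite_indep by (auto simp: J_def bases_iff)
  have "Z \<in> bases (delete M X) \<longleftrightarrow> Z \<subseteq> ground M - X \<and> Z \<union> J \<in> bases M" for Z
  proof
    assume Z: "Z \<in> bases (delete M X)"
    then have i: "Z \<in> indep M" "Z \<inter> X = {}" "card Z = card Z0"
      using i0 by (auto simp: D.bases_iff) (auto simp: delete_def)
    have "card Z \<le> card B0" using card_le_rank[OF i(1)] B0 by (simp add: bases_iff)
    then obtain K where K: "K \<in> indep M" "Z \<subseteq> K" "K \<subseteq> Z \<union> B0" "card K = rank M"
      using augment_within[OF i(1), of B0 "card B0"] B0 by (auto simp: bases_iff)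
    \<comment> \<open>Elements of \<open>B0\<close> outside \<open>J\<close> belong to
      \<open>Z0\<close>, hence avoid \<open>X\<close>; since \<open>Z\<close> is maximal among
      independent sets avoiding \<open>X\<close>, none of them can be added to it.\<close>
    have "K \<subseteq> Z \<union> J"
    proof
      fix z assume z: "z \<in> K"
      show "z \<in> Z \<union> J"
      proof (rule ccontr)
        assume "z \<notin> Z \<union> J"
        then have "z \<in> Z0" "z \<notin> Z" using z K by (auto simp: J_def)
        then have "insert z Z \<notin> indep M" using maxi[OF Z] i0 by auto
        moreover have "insert z Z \<in> indep M" using z K indep_mono[of K "insert z Z"] by auto
        ultimately show False by simp
      qed
    qed
    moreover have "card (Z \<union> J) = rank M"
      using i JX finJ cJ finite_indep by (subst card_Un_disjoint) auto
    ultimately have "K = Z \<union> J" using K finJ i finite_indep by (intro card_subset_eq) auto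
    then show "Z \<subseteq> ground M - X \<and> Z \<union> J \<in> bases M"
      using K i indep_subset by (auto simp: bases_iff)
  next
    assume Z: "Z \<subseteq> ground M - X \<and> Z \<union> J \<in> bases M"
    then have "card Z + card J = rank M"
      using JX finJ finite_ground finite_subset[of Z "ground M - X"]
      by (auto simp: bases_iff) (subst card_Un_disjoint[symmetric], auto)
    then have "card Z = rank (delete M X)" using i0 cJ by simp
    moreover have "Z \<in> indep M" using Z by (auto simp: bases_iff intro: indep_mono)
    ultimately show "Z \<in> bases (delete M X)" using Z by (auto simp: D.bases_iff) (auto simp: delete_def)
  qed
  then show ?thesis using JX by blast
qed

lemma bases_delete_spanning:
  assumes "B \<in> bases M" "B \<inter> X = {}"
  shows "bases (delete M X) = {Z \<in> bases M. Z \<inter> X = {}}"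
proof -
  interpret D: matroid "delete M X" by (rule matroid_delete)
  have "B \<in> bases (delete M X)"
    using assms by (auto simp: bases_def delete_def)
  then have "rank (delete M X) = rank M" using assms by (simp add: D.bases_iff bases_iff)
  then show ?thesis by (auto simp: D.bases_iff bases_iff) (auto simp: delete_def)
qed

lemma matroid_contract: "matroid (contract M X)"
  unfolding contract_def by (intro matroid.matroid_dual matroid.matroid_delete matroid_dual)

lemma mem_bases_contract:
  assumes "Z \<subseteq> ground M - X"
  shows "Z \<in> bases (contract M X) \<longleftrightarrow> ground M - X - Z \<in> bases (delete (dual M) X)"
proof -
  interpret D: matroid "dual M" by (rule matroid_dual)
  interpret DD: matroid "delete (dual M) X" by (rule D.matroid_delete)
  show ?thesis
    using DD.compl_mem_bases_dual[of "ground M - X - Z"] assms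
    by (simp add: contract_def double_diff)
qed

text \<open>Dual to \<open>bases_delete\<close>: if \<open>J\<close> completes the bases of the
  deletion in the dual, its complement \<open>X - J\<close> completes those of the
  contraction.\<close>

lemma bases_contract:
  assumes "X \<subseteq> ground M"
  shows "\<exists>P \<subseteq> X. bases (contract M X) = {Z. Z \<subseteq> ground M - X \<and> Z \<union> P \<in> bases M}"
proof -
  interpret D: matroid "dual M" by (rule matroid_dual)
  obtain J where J: "J \<subseteq> X" and bd: "bases (delete (dual M) X) = {Z. Z \<subseteq> ground M - X \<and> Z \<union> J \<in> bases (dual M)}"
    using D.bases_delete[of X] by auto
  interpret C: matroid "contract M X" by (rule matroid_contract)
  have "Z \<in> bases (contract M X) \<longleftrightarrow> Z \<subseteq> ground M - X \<and> Z \<union> (X - J) \<in> bases M" for Z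
  proof (cases "Z \<subseteq> ground M - X")
    case False then show ?thesis using C.basis_subset by auto
  next
    case True
    have "Z \<in> bases (contract M X) \<longleftrightarrow> ground M - X - Z \<in> bases (delete (dual M) X)"
      using True by (rule mem_bases_contract)
    also have "\<dots> \<longleftrightarrow> (ground M - X - Z) \<union> J \<in> bases (dual M)" using bd by auto
    also have "(ground M - X - Z) \<union> J = ground M - (Z \<union> (X - J))" using J assms True by auto
    also have "\<dots> \<in> bases (dual M) \<longleftrightarrow> Z \<union> (X - J) \<in> bases M"
      using True assms by (intro compl_mem_bases_dual) auto
    finally show ?thesis using True by simp
  qed
  then show ?thesis by (intro exI[of _ "X - J"]) auto
qed

text \<open>Composes the completing sets of the contraction and the deletion. Whatever sets were
  used to form the minor, \<open>P\<close> acts as the contracted part and the other missing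
  elements as the deleted part.\<close>

lemma minor_bases:
  assumes "is_minor N M"
  shows "matroid N" "ground N \<subseteq> ground M"
    "\<exists>P. P \<subseteq> ground M - ground N \<and> bases N = {Z. Z \<subseteq> ground N \<and> Z \<union> P \<in> bases M}"
proof -
  obtain X Y where XY: "X \<subseteq> ground M" "Y \<subseteq> ground M" "X \<inter> Y = {}" and N: "N = delete (contract M X) Y"
    using assms by (auto simp: is_minor_def)
  interpret C: matroid "contract M X" by (rule matroid_contract)
  show "matroid N" unfolding N by (rule C.matroid_delete)
  show "ground N \<subseteq> ground M" by (auto simp: N)
  obtain P where P: "P \<subseteq> X" "bases (contract M X) = {Z. Z \<subseteq> ground M - X \<and> Z \<union> P \<in> bases M}"
    using bases_contract[OF XY(1)] by auto
  obtain J where J: "J \<subseteq> Y" "bases N = {Z. Z \<subseteq> ground (contract M X) - Y \<and> Z \<union> J \<in> bases (contract M X)}"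
    using C.bases_delete[of Y] by (auto simp: N)
  have JX: "J \<subseteq> ground M - X" using J(1) XY by auto
  have "bases N = {Z. Z \<subseteq> ground N \<and> Z \<union> (J \<union> P) \<in> bases M}"
    unfolding J(2) P(2) using JX by (auto simp: N Un_assoc)
  moreover have "J \<union> P \<subseteq> ground M - ground N" using J P XY by (auto simp: N)
  ultimately show "\<exists>P. P \<subseteq> ground M - ground N \<and> bases N = {Z. Z \<subseteq> ground N \<and> Z \<union> P \<in> bases M}"
    by blast
qed

text \<open>Converse of \<open>minor_bases\<close>. The witness \<open>Z0\<close> shows that
  \<open>P\<close> is independent and that \<open>R \<union> P\<close> spans, so contracting
  \<open>P\<close> and deleting the rest calls for no other completing set.\<close>

lemma minor_exists:
  assumes PR: "P \<subseteq> ground M" "R \<subseteq> ground M" "P \<inter> R = {}" and Z0: "Z0 \<subseteq> R" "Z0 \<union> P \<in> bases M"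
  obtains N where "is_minor N M" "matroid N" "ground N = R"
    "bases N = {Z. Z \<subseteq> R \<and> Z \<union> P \<in> bases M}"
proof -
  define Y where "Y = ground M - P - R"
  define N where "N = delete (contract M P) Y"
  interpret D: matroid "dual M" by (rule matroid_dual)
  interpret C: matroid "contract M P" by (rule matroid_contract)
  have m: "is_minor N M" unfolding is_minor_def N_def using PR by (intro exI[of _ P] exI[of _ Y]) (auto simp: Y_def)
  have "ground M - (Z0 \<union> P) \<in> bases (dual M)" using Z0 by (auto simp: bases_dual)
  then have bd: "bases (delete (dual M) P) = {Z \<in> bases (dual M). Z \<inter> P = {}}"
    by (rule D.bases_delete_spanning) auto
  have bc: "bases (contract M P) = {Z. Z \<subseteq> ground M - P \<and> Z \<union> P \<in> bases M}"
  proof -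
    have "Z \<in> bases (contract M P) \<longleftrightarrow> Z \<union> P \<in> bases M" if Z: "Z \<subseteq> ground M - P" for Z
    proof -
      have "Z \<in> bases (contract M P) \<longleftrightarrow> ground M - P - Z \<in> bases (delete (dual M) P)"
        using Z by (rule mem_bases_contract)
      also have "ground M - P - Z = ground M - (Z \<union> P)" by auto
      also have "\<dots> \<in> bases (delete (dual M) P) \<longleftrightarrow> ground M - (Z \<union> P) \<in> bases (dual M)" using bd by auto
      also have "\<dots> \<longleftrightarrow> Z \<union> P \<in> bases M" using Z PR by (intro compl_mem_bases_dual) auto
      finally show ?thesis .
    qed
    then show ?thesis using C.basis_subset by auto
  qed
  have "Z0 \<in> bases (contract M P)" using Z0 PR bc by auto
  then have "bases N = {Z \<in> bases (contract M P). Z \<inter> Y = {}}"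
    unfolding N_def using Z0 by (intro C.bases_delete_spanning) (auto simp: Y_def)
  then have "bases N = {Z. Z \<subseteq> R \<and> Z \<union> P \<in> bases M}"
  proof -
    have "Z \<subseteq> ground M - P \<and> Z \<inter> Y = {} \<longleftrightarrow> Z \<subseteq> R" for Z
      using PR unfolding Y_def by blast
    then show ?thesis unfolding \<open>bases N = _\<close> bc by blast
  qed
  moreover have "ground N = R" using PR by (auto simp: N_def Y_def)
  ultimately show ?thesis using that m minor_bases(1)[OF m] by blast
qed

end

section \<open>Free extensions and coextensions\<close>

context matroid
begin

lemma dep_contains_circuit:
  assumes "X \<subseteq> ground M" "X \<notin> indep M"
  obtains C where "C \<in> circuits M" "C \<subseteq> X"
proof -
  have "finite X" using assms(1) finite_ground by (rule finite_subset)
  then have "\<exists>C \<in> circuits M. C \<subseteq> X" using assms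
  proof (induction X rule: finite_psubset_induct)
    case (psubset X)
    show ?case
    proof (cases "\<forall>D. D \<subset> X \<longrightarrow> D \<in> indep M")
      case True then show ?thesis using psubset.prems by (auto simp: circuits_def)
    next
      case False
      then obtain D where D: "D \<subset> X" "D \<notin> indep M" by auto
      then have "\<exists>C\<in>circuits M. C \<subseteq> D" using psubset.prems by (intro psubset.IH) auto
      then show ?thesis using D by blast
    qed
  qed
  then show ?thesis using that by auto
qed

lemma ground_free_extension [simp]: "ground (free_extension M x) = insert x (ground M)"
  by (simp add: free_extension_def of_circuits_def)

text \<open>If \<open>x\<close> is in \<open>I\<close> and \<open>I - {x}\<close> is independent,
  then \<open>I\<close> contains a circuit \<open>insert x B\<close> exactly when
  \<open>I - {x}\<close> is a basis. Hence all new circuits together only bound the size.\<close>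

lemma indep_free_extension:
  assumes x: "x \<notin> ground M"
  shows "I \<in> indep (free_extension M x) \<longleftrightarrow> finite I \<and> I - {x} \<in> indep M \<and> card I \<le> rank M"
proof
  assume "I \<in> indep (free_extension M x)"
  then have I: "I \<subseteq> insert x (ground M)" and c: "\<And>C. C \<in> circuits M \<Longrightarrow> \<not> C \<subseteq> I"
    and b: "\<And>B. B \<in> bases M \<Longrightarrow> \<not> insert x B \<subseteq> I"
  proof -
    have "I \<subseteq> insert x (ground M) \<and> (\<forall>C\<in>circuits M \<union> {insert x B |B. B \<in> bases M}. \<not> C \<subseteq> I)"
      using \<open>I \<in> indep (free_extension M x)\<close> by (simp add: free_extension_def of_circuits_def)
    then show "I \<subseteq> insert x (ground M)" "\<And>C. C \<in> circuits M \<Longrightarrow> \<not> C \<subseteq> I"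
      "\<And>B. B \<in> bases M \<Longrightarrow> \<not> insert x B \<subseteq> I" by blast+
  qed
  have fin: "finite I" using I finite_ground finite_subset by blast
  have i: "I - {x} \<in> indep M"
  proof (rule ccontr)
    assume "\<not> ?thesis"
    then obtain C where "C \<in> circuits M" "C \<subseteq> I - {x}"
      using dep_contains_circuit[of "I - {x}"] I by auto
    then show False using c by auto
  qed
  have "card I \<le> rank M"
  proof (cases "x \<in> I")
    case True
    then have "I - {x} \<notin> bases M" using b[of "I - {x}"] by auto
    then show ?thesis
      using i card_le_rank[OF i] fin True by (auto simp: bases_iff)
  qed (use card_le_rank[OF i] in simp)
  then show "finite I \<and> I - {x} \<in> indep M \<and> card I \<le> rank M" using fin i by simp
next
  assume I: "finite I \<and> I - {x} \<in> indep M \<and> card I \<le> rank M"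
  then have i: "I - {x} \<in> indep M" by simp
  have "\<not> C \<subseteq> I" if "C \<in> circuits M" for C
  proof
    assume "C \<subseteq> I"
    then have "C \<subseteq> I - {x}" using that x by (auto simp: circuits_def)
    then show False using indep_mono[OF i] that by (auto simp: circuits_def)
  qed
  moreover have "\<not> insert x B \<subseteq> I" if B: "B \<in> bases M" for B
  proof
    assume s: "insert x B \<subseteq> I"
    have "x \<notin> B" "finite B" using B basis_subset x finite_indep by (auto simp: bases_iff)
    then have "card (insert x B) = Suc (rank M)" using B by (simp add: bases_iff)
    then show False using card_mono[OF _ s] I by simp
  qed
  moreover have "I \<subseteq> insert x (ground M)" using indep_subset[OF i] by auto
  ultimately show "I \<in> indep (free_extension M x)"
    by (auto simp: free_extension_def of_circuits_def)
qed

text \<open>If \<open>x\<close> lies in \<open>J\<close> but not in \<open>I\<close>, then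
  \<open>x\<close> itself augments \<open>I\<close>. Otherwise the strict inequality of sizes
  survives the removal of \<open>x\<close>, and augmentation in \<open>M\<close> applies.\<close>

lemma matroid_free_extension:
  assumes x: "x \<notin> ground M"
  shows "matroid (free_extension M x)"
proof
  note simps = indep_free_extension[OF x]
  show "finite (ground (free_extension M x))" by (simp add: finite_ground)
  show "{} \<in> indep (free_extension M x)" by (simp add: simps indep_empty)
  show "I \<subseteq> ground (free_extension M x)" if "I \<in> indep (free_extension M x)" for I
    using that indep_subset[of "I - {x}"] by (auto simp: simps)
  show "I \<in> indep (free_extension M x)" if J: "J \<in> indep (free_extension M x)" and "I \<subseteq> J" for I J
  proof -
    have "finite J" using J by (simp add: simps)
    then have "card I \<le> card J" using \<open>I \<subseteq> J\<close> by (rule card_mono)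
    moreover have "I - {x} \<in> indep M" using J indep_mono[of "J - {x}" "I - {x}"] \<open>I \<subseteq> J\<close> by (auto simp: simps)
    ultimately show ?thesis using J \<open>I \<subseteq> J\<close> finite_subset by (auto simp: simps)
  qed
  show "\<exists>y\<in>J - I. insert y I \<in> indep (free_extension M x)"
    if I: "I \<in> indep (free_extension M x)" and J: "J \<in> indep (free_extension M x)" and less: "card I < card J" for I J
  proof (cases "x \<in> J - I")
    case True
    then show ?thesis using I J less by (intro bexI[of _ x]) (auto simp: simps)
  next
    case False
    have fin: "finite I" "finite J" using I J by (auto simp: simps)
    have "card (I - {x}) < card (J - {x})"
    proof (cases "x \<in> I")
      case True
      then show ?thesis using False less fin card_Suc_Diff1[of I x] card_Diff_singleton_if[of J x] by auto
    next
      case xI: False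
      then show ?thesis using False less by simp
    qed
    then obtain y where y: "y \<in> J - {x} - (I - {x})" "insert y (I - {x}) \<in> indep M"
      using indep_augment I J by (metis simps)
    then have "insert y I - {x} = insert y (I - {x})" by auto
    moreover have "card (insert y I) \<le> rank M"
      using card_insert_le_m1[of "card J" I y] I J less by (auto simp: simps card_insert_if)
    ultimately have "insert y I \<in> indep (free_extension M x)" using y fin by (simp add: simps)
    then show ?thesis using y by blast
  qed
qed

lemma bases_free_extension:
  assumes x: "x \<notin> ground M"
  shows "W \<in> bases (free_extension M x) \<longleftrightarrow> W \<subseteq> insert x (ground M) \<and> card W = rank M \<and> (\<exists>B\<in>bases M. W - {x} \<subseteq> B)"
proof -
  interpret E: matroid "free_extension M x" using x by (rule matroid_free_extension)
  obtain B where B: "B \<in> bases M" by (rule basis_exists)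
  then have "B - {x} = B" "B \<in> indep M" "card B = rank M" using basis_subset[OF B] x by (auto simp: bases_iff)
  then have "rank M \<le> rank (free_extension M x)"
    using E.card_le_rank[of B] finite_indep by (auto simp: indep_free_extension[OF x])
  moreover have "rank (free_extension M x) \<le> rank M"
  proof -
    obtain C where "C \<in> bases (free_extension M x)" by (rule E.basis_exists)
    then show ?thesis by (simp add: E.bases_iff indep_free_extension[OF x])
  qed
  ultimately have "W \<in> bases (free_extension M x) \<longleftrightarrow> W \<in> indep (free_extension M x) \<and> card W = rank M"
    by (simp add: E.bases_iff)
  moreover have "W \<subseteq> insert x (ground M)" if "W \<in> indep (free_extension M x)"
    using E.indep_subset[OF that] by simp
  moreover have "finite W" if "W \<subseteq> insert x (ground M)"
    using that finite_ground by (meson finite_insert finite_subset)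
  ultimately show ?thesis
    unfolding indep_free_extension[OF x] indep_iff_subset_basis by (metis order_refl)
qed

lemma ground_free_coextension [simp]: "ground (free_coextension M x) = insert x (ground M)"
  using matroid.ground_free_extension[OF matroid_dual] by (simp add: free_coextension_def)

lemma matroid_free_coextension: "x \<notin> ground M \<Longrightarrow> matroid (free_coextension M x)"
  unfolding free_coextension_def
  by (intro matroid.matroid_dual matroid.matroid_free_extension matroid_dual) simp

text \<open>Complements in \<open>bases_free_extension\<close> for the dual: lying inside a basis of
  the dual turns into containing a basis of \<open>M\<close>.\<close>

lemma bases_free_coextension:
  assumes x: "x \<notin> ground M"
  shows "W \<in> bases (free_coextension M x) \<longleftrightarrow>
    W \<subseteq> insert x (ground M) \<and> card W = Suc (rank M) \<and> (\<exists>B\<in>bases M. B \<subseteq> W)"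
proof (cases "W \<subseteq> insert x (ground M)")
  case False
  then show ?thesis using matroid.basis_subset[OF matroid_free_coextension[OF x], of W] by auto
next
  case W: True
  let ?E = "insert x (ground M)"
  interpret D: matroid "dual M" by (rule matroid_dual)
  interpret E: matroid "free_extension (dual M) x" using x by (intro D.matroid_free_extension) simp
  have fE: "finite ?E" by (simp add: finite_ground)
  have rk: "rank M \<le> card (ground M)"
    using rank_of_le_card[of "ground M"] finite_ground by (simp add: rank_def)
  have "W \<in> bases (free_coextension M x) \<longleftrightarrow> ?E - W \<in> bases (free_extension (dual M) x)"
    using E.compl_mem_bases_dual[of "?E - W"] W by (simp add: free_coextension_def double_diff)
  also have "\<dots> \<longleftrightarrow> card (?E - W) = rank (dual M) \<and> (\<exists>B\<in>bases (dual M). ?E - W - {x} \<subseteq> B)"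
    using D.bases_free_extension[of x "?E - W"] x by simp
  also have "card (?E - W) = rank (dual M) \<longleftrightarrow> card W = Suc (rank M)"
    using card_Diff_subset[OF finite_subset[OF W fE] W] card_mono[OF fE W] rk x finite_ground
    by (auto simp: rank_dual)
  also have "(\<exists>B\<in>bases (dual M). ?E - W - {x} \<subseteq> B) \<longleftrightarrow> (\<exists>B\<in>bases M. B \<subseteq> W)"
  proof -
    have "?E - W - {x} \<subseteq> ground M - B \<longleftrightarrow> B \<subseteq> W" if "B \<in> bases M" for B
      using basis_subset[OF that] x by blast
    then show ?thesis by (simp add: bases_dual)
  qed
  finally show ?thesis using W by simp
qed

end

text \<open>The bases of the matroid obtained from \<open>M\<close> by free coextension by the elements of \<open>A\<close>,
  followed by free extension by the elements of \<open>B\<close>.\<close>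

definition amplified :: "'a indep_system \<Rightarrow> 'a set \<Rightarrow> 'a set \<Rightarrow> 'a set set" where
  "amplified M A B = {X. X \<subseteq> ground M \<union> A \<union> B \<and> card X = rank M + card A \<and>
     rank M \<le> rank_of M (X \<inter> ground M) + card (X \<inter> B)}"

section \<open>Iterated free coextension and extension\<close>

lemma superset_of_card:
  assumes "finite W" "I \<subseteq> W" "card I \<le> n" "n \<le> card W"
  obtains X where "I \<subseteq> X" "X \<subseteq> W" "card X = n"
proof -
  have "n - card I \<le> card (W - I)"
    using assms by (simp add: card_Diff_subset finite_subset)
  then obtain Y where Y: "Y \<subseteq> W - I" "card Y = n - card I" by (meson obtain_subset_with_card_n)
  have "card (I \<union> Y) = n"
    using Y assms finite_subset[of Y W] finite_subset[of I W] by (subst card_Un_disjoint) auto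
  then show ?thesis using that[of "I \<union> Y"] Y assms by auto
qed

lemma (in matroid) amplified_coextension:
  assumes "finite A" "A \<inter> ground M = {}"
  shows "\<exists>N. obtainable M N \<and> matroid N \<and> ground N = ground M \<union> A \<and> bases N = amplified M A {}"
  using assms
proof (induction A rule: finite_induct)
  case empty
  have "bases M = amplified M {} {}"
  proof (intro set_eqI iffI)
    fix X assume "X \<in> bases M"
    then show "X \<in> amplified M {} {}"
      using basis_subset[of X] card_le_rank_of[of X X] by (auto simp: amplified_def bases_iff Int_absorb2)
  next
    fix X assume "X \<in> amplified M {} {}"
    then have "X \<subseteq> ground M" "card X = rank M" "rank M \<le> rank_of M X"
      by (auto simp: amplified_def Int_absorb2)
    then show "X \<in> bases M"
      using finite_ground finite_subset dep_iff_rank_of by (metis bases_iff not_le)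
  qed
  then show ?case using matroid_axioms obtainable.start by auto
next
  case (insert a A)
  then obtain N where N: "obtainable M N" "matroid N" "ground N = ground M \<union> A" "bases N = amplified M A {}"
    by auto
  interpret N: matroid N by fact
  have a: "a \<notin> ground N" using insert N by auto
  obtain B where "B \<in> bases N" by (rule N.basis_exists)
  then have "card B = rank N" "B \<in> amplified M A {}" using N.bases_iff[of B] by (auto simp: N(4))
  then have rN: "rank N = rank M + card A" by (simp add: amplified_def)
  have "W \<in> bases (free_coextension N a) \<longleftrightarrow> W \<in> amplified M (insert a A) {}" for W
  proof
    assume "W \<in> bases (free_coextension N a)"
    then obtain B where "W \<subseteq> insert a (ground N)" "card W = Suc (rank N)" "B \<in> amplified M A {}" "B \<subseteq> W"
      using N.bases_free_coextension[OF a] N by auto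
    moreover from this have "rank_of M (B \<inter> ground M) \<le> rank_of M (W \<inter> ground M)"
      by (intro rank_of_mono) auto
    ultimately show "W \<in> amplified M (insert a A) {}"
      using insert.hyps rN N by (auto simp: amplified_def)
  next
    assume "W \<in> amplified M (insert a A) {}"
    then have W: "W \<subseteq> insert a (ground N)" "card W = Suc (rank N)" "rank M \<le> rank_of M (W \<inter> ground M)"
      using insert.hyps rN N by (auto simp: amplified_def)
    have fW: "finite W" using W(1) N.finite_ground finite_subset by blast
    obtain I where I: "I \<in> indep M" "I \<subseteq> W \<inter> ground M" "card I = rank_of M (W \<inter> ground M)"
      by (rule rank_of_witness)
    have cI: "card I = rank M" using I(3) W(3) card_le_rank[OF I(1)] by simp
    have aW: "I \<subseteq> W - {a}" using I a N by auto
    have "rank M + card A \<le> card (W - {a})" using W rN fW by (cases "a \<in> W") auto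
    \<comment> \<open>\<open>X\<close> must be a basis of \<open>N\<close> inside \<open>W\<close>,
      hence avoid \<open>a\<close>; keeping the basis \<open>I\<close> of \<open>M\<close> secures
      the rank condition, and the rest is filled up arbitrarily.\<close>
    then obtain X where X: "I \<subseteq> X" "X \<subseteq> W - {a}" "card X = rank M + card A"
      using superset_of_card[OF _ aW, of "rank M + card A"] cI fW by auto
    have "rank M \<le> rank_of M (X \<inter> ground M)"
      using card_le_rank_of[OF I(1), of "X \<inter> ground M"] I X cI by auto
    then have "X \<in> bases N" using X W N by (auto simp: amplified_def)
    then show "W \<in> bases (free_coextension N a)"
      using N.bases_free_coextension[OF a] W X by auto
  qed
  then have "bases (free_coextension N a) = amplified M (insert a A) {}" by blast
  then show ?case
    using obtainable.coext[OF N(1) a] N.matroid_free_coextension[OF a] N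
    by (intro exI[of _ "free_coextension N a"]) auto
qed

text \<open>Induction on \<open>B\<close>, starting from the coextension. The new element
  \<open>b\<close> raises the count in the defining inequality by one, which is the rank that a
  single element replacing \<open>b\<close> can contribute.\<close>

lemma (in matroid) amplified_extension:
  assumes "finite A" "A \<inter> ground M = {}" "finite B" "B \<inter> (ground M \<union> A) = {}"
  shows "\<exists>N. obtainable M N \<and> matroid N \<and> ground N = ground M \<union> A \<union> B \<and> bases N = amplified M A B"
  using assms(3,4)
proof (induction B rule: finite_induct)
  case empty
  then show ?case using amplified_coextension[OF assms(1,2)] by simp
next
  case (insert b B)
  then obtain N where N: "obtainable M N" "matroid N" "ground N = ground M \<union> A \<union> B" "bases N = amplified M A B"
    by auto
  interpret N: matroid N by fact
  have b: "b \<notin> ground N" using insert N by auto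
  obtain B0 where "B0 \<in> bases N" by (rule N.basis_exists)
  then have "card B0 = rank N" "B0 \<in> amplified M A B" using N.bases_iff[of B0] by (auto simp: N(4))
  then have rN: "rank N = rank M + card A" by (simp add: amplified_def)
  have "W \<in> bases (free_extension N b) \<longleftrightarrow> W \<in> amplified M A (insert b B)" for W
  proof (cases "W \<subseteq> insert b (ground N) \<and> card W = rank N")
    case False
    then show ?thesis using N.bases_free_extension[OF b] N rN by (auto simp: amplified_def)
  next
    case W: True
    then have fW: "finite W" using N.finite_ground finite_subset by blast
    have iff: "W \<in> bases (free_extension N b) \<longleftrightarrow> (\<exists>X\<in>amplified M A B. W - {b} \<subseteq> X)"
      using N.bases_free_extension[OF b] W N by auto
    have iff2: "W \<in> amplified M A (insert b B) \<longleftrightarrow> rank M \<le> rank_of M (W \<inter> ground M) + card (W \<inter> insert b B)"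
      using W rN N by (auto simp: amplified_def)
    have bX: "b \<notin> X" "finite X" "X \<subseteq> ground N" "card X = rank N" if "X \<in> amplified M A B" for X
      using that b N.basis_subset[of X] N.finite_indep by (auto simp: N(4)[symmetric] N.bases_iff)
    show ?thesis
    proof (cases "b \<in> W")
      case False
      have "W \<in> bases (free_extension N b) \<longleftrightarrow> W \<in> amplified M A B"
      proof -
        have "W = X" if "X \<in> amplified M A B" "W \<subseteq> X" for X
          using bX[OF that(1)] that(2) W card_subset_eq[of X W] by simp
        then show ?thesis unfolding iff using False by auto
      qed
      then show ?thesis using False W rN N unfolding iff2 by (auto simp: amplified_def)
    next
      case True
      have cB: "card (W \<inter> insert b B) = Suc (card (W \<inter> B))"
        using True insert.hyps fW by simp
      have cW: "Suc (card (W - {b})) = rank N" using card_Suc_Diff1[OF fW True] W by simp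
      have bS: "b \<notin> ground M" using b N by auto
      show ?thesis
      proof
        assume "W \<in> bases (free_extension N b)"
        then obtain X where X: "X \<in> amplified M A B" "W - {b} \<subseteq> X" using iff by auto
        \<comment> \<open>\<open>X\<close> arises from \<open>W\<close> by trading \<open>b\<close>
          for one element \<open>y\<close>. That element adds at most one to either the rank term or
          the count in \<open>B\<close>, and \<open>b\<close> makes up for it.\<close>
        have "card (X - (W - {b})) = 1" using X bX[OF X(1)] cW fW by (simp add: card_Diff_subset)
        then obtain y where y: "X - (W - {b}) = {y}" by (auto simp: card_1_singleton_iff)
        have "rank M \<le> rank_of M (X \<inter> ground M) + card (X \<inter> B)" using X by (simp add: amplified_def)
        also have "\<dots> \<le> rank_of M (W \<inter> ground M) + Suc (card (W \<inter> B))"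
        proof (cases "y \<in> ground M")
          case True
          then have "y \<notin> B" using insert by auto
          then have "X \<inter> B \<subseteq> W \<inter> B" "X \<inter> ground M \<subseteq> insert y (W \<inter> ground M)" using y by auto
          then show ?thesis
            using card_mono[of "W \<inter> B" "X \<inter> B"] fW rank_of_insert_le[of y "W \<inter> ground M"]
              rank_of_mono[of "X \<inter> ground M" "insert y (W \<inter> ground M)"] by auto
        next
          case False
          then have "X \<inter> B \<subseteq> insert y (W \<inter> B)" "X \<inter> ground M \<subseteq> W \<inter> ground M" using y by auto
          then show ?thesis
            using card_mono[of "insert y (W \<inter> B)" "X \<inter> B"] fW card_insert_le_m1[of _ "W \<inter> B" y]
              rank_of_mono[of "X \<inter> ground M" "W \<inter> ground M"]
            by (auto simp: card_insert_if split: if_splits)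
        qed
        finally show "W \<in> amplified M A (insert b B)" unfolding iff2 cB .
      next
        assume "W \<in> amplified M A (insert b B)"
        then have r: "rank M \<le> rank_of M (W \<inter> ground M) + Suc (card (W \<inter> B))" unfolding iff2 cB .
        \<comment> \<open>The replacement for \<open>b\<close>: any missing element if the
          inequality already holds without \<open>b\<close>, and otherwise an element of
          \<open>M\<close> that raises the rank.\<close>
        have "\<exists>y \<in> ground N - (W - {b}). rank M \<le> rank_of M (insert y W \<inter> ground M) + card (W \<inter> B)"
        proof (cases "rank M \<le> rank_of M (W \<inter> ground M) + card (W \<inter> B)")
          case True
          have "\<not> ground N \<subseteq> W - {b}"
          proof
            assume "ground N \<subseteq> W - {b}"
            then have "card (ground N) < rank N" using cW card_mono[of "W - {b}" "ground N"] fW by simp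
            then show False using N.rank_of_le_card[OF N.finite_ground] by (simp add: rank_def)
          qed
          then obtain y where "y \<in> ground N - (W - {b})" by auto
          moreover have "rank_of M (W \<inter> ground M) \<le> rank_of M (insert y W \<inter> ground M)"
            by (intro rank_of_mono) auto
          ultimately show ?thesis using True by (intro bexI[of _ y]) auto
        next
          case False
          then have "rank_of M (W \<inter> ground M) < rank M" by simp
          then obtain y where y: "y \<in> ground M - W \<inter> ground M"
            "rank_of M (insert y (W \<inter> ground M)) = Suc (rank_of M (W \<inter> ground M))"
            by (rule rank_of_extend)
          then show ?thesis using r N by (intro bexI[of _ y]) auto
        qed
        then obtain y where y: "y \<in> ground N" "y \<notin> W - {b}"
          "rank M \<le> rank_of M (insert y W \<inter> ground M) + card (W \<inter> B)" by auto
        define X where "X = insert y (W - {b})"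
        have "X \<inter> ground M = insert y W \<inter> ground M" using bS by (auto simp: X_def)
        moreover have "card (W \<inter> B) \<le> card (X \<inter> B)"
          using insert.hyps fW by (intro card_mono) (auto simp: X_def)
        moreover have "card X = rank N" using y fW cW by (simp add: X_def)
        moreover have "X \<subseteq> ground N" using W y by (auto simp: X_def)
        ultimately have "X \<in> amplified M A B" using y rN N by (auto simp: amplified_def)
        then show "W \<in> bases (free_extension N b)" unfolding iff by (auto simp: X_def)
      qed
    qed
  qed
  then have "bases (free_extension N b) = amplified M A (insert b B)" by blast
  then show ?case
    using obtainable.ext[OF N(1) b] N.matroid_free_extension[OF b] N
    by (intro exI[of _ "free_extension N b"]) auto
qed

section \<open>Isomorphisms\<close>

text \<open>An isomorphism preserves sizes and independence, so the ranks agree and bases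
  correspond. Minors are compared in this form below.\<close>

lemma isomorphic_bases:
  assumes "matroid M" "matroid N" "isomorphic M N"
  obtains f where "bij_betw f (ground M) (ground N)"
    "\<And>Z. Z \<subseteq> ground M \<Longrightarrow> Z \<in> bases M \<longleftrightarrow> f ` Z \<in> bases N"
proof -
  interpret M: matroid M by fact
  interpret N: matroid N by fact
  obtain f where f: "bij_betw f (ground M) (ground N)"
    "\<And>I. I \<subseteq> ground M \<Longrightarrow> I \<in> indep M \<longleftrightarrow> f ` I \<in> indep N"
    using assms(3) by (auto simp: isomorphic_def)
  have card: "card (f ` Z) = card Z" if "Z \<subseteq> ground M" for Z
    using f(1) that by (metis bij_betw_def card_image inj_on_subset)
  have "rank M \<le> rank N"
  proof -
    obtain B where B: "B \<in> bases M" by (rule M.basis_exists)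
    then have "f ` B \<in> indep N" "card (f ` B) = rank M"
      using f(2) card M.basis_subset[OF B] by (simp_all add: M.bases_iff)
    then show ?thesis using N.card_le_rank[of "f ` B"] by simp
  qed
  moreover have "rank N \<le> rank M"
  proof -
    obtain B where B: "B \<in> bases N" by (rule N.basis_exists)
    then have "B \<subseteq> f ` ground M" using N.basis_subset f(1) by (simp add: bij_betw_def)
    then obtain Z where "Z \<subseteq> ground M" "B = f ` Z" by (auto simp: subset_image_iff)
    then show ?thesis using B f(2) card M.card_le_rank by (metis N.bases_iff)
  qed
  ultimately have "Z \<in> bases M \<longleftrightarrow> f ` Z \<in> bases N" if "Z \<subseteq> ground M" for Z
    using f(2)[OF that] card[OF that] by (simp add: M.bases_iff N.bases_iff)
  then show ?thesis using that f(1) by blast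
qed

lemma isomorphicI:
  assumes "matroid M" "matroid N" "bij_betw f (ground M) (ground N)"
    "\<And>Z. Z \<subseteq> ground M \<Longrightarrow> Z \<in> bases M \<longleftrightarrow> f ` Z \<in> bases N"
  shows "isomorphic M N"
  unfolding isomorphic_def
proof (intro exI[of _ f] conjI allI impI)
  interpret M: matroid M by fact
  interpret N: matroid N by fact
  fix I assume I: "I \<subseteq> ground M"
  have inj: "inj_on f (ground M)" and im: "f ` ground M = ground N" using assms(3) by (auto simp: bij_betw_def)
  show "I \<in> indep M \<longleftrightarrow> f ` I \<in> indep N"
  proof
    assume "I \<in> indep M"
    show "f ` I \<in> indep N"
    proof -
      obtain B where B: "B \<in> bases M" "I \<subseteq> B"
        using \<open>I \<in> indep M\<close> by (auto simp: M.indep_iff_subset_basis)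
      then have "f ` B \<in> bases N" using assms(4) M.basis_subset by blast
      then show ?thesis using B by (auto simp: N.indep_iff_subset_basis)
    qed
  next
    assume "f ` I \<in> indep N"
    then obtain B where B: "B \<in> bases N" "f ` I \<subseteq> B" by (auto simp: N.indep_iff_subset_basis)
    then have "B \<subseteq> f ` ground M" using N.basis_subset im by simp
    then obtain Z where Z: "Z \<subseteq> ground M" "B = f ` Z" by (auto simp: subset_image_iff)
    have "I \<subseteq> Z"
    proof
      fix x assume "x \<in> I"
      then have "f x \<in> f ` Z" "x \<in> ground M" using B Z I by auto
      then show "x \<in> Z" using inj_on_image_mem_iff[OF inj _ Z(1)] by blast
    qed
    then show "I \<in> indep M" using Z B assms(4)[OF Z(1)] by (auto simp: M.indep_iff_subset_basis)
  qed
qed fact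

section \<open>Free and cofree elements\<close>

text \<open>Equivalently, every circuit through \<open>x\<close> has more than \<open>rank M\<close>
  elements; coloops are included.\<close>

definition free_elements :: "'a indep_system \<Rightarrow> 'a set" where
  "free_elements M = {x \<in> ground M. \<forall>W\<in>nonbases M. W - {x} \<notin> indep M}"

text \<open>The dual notion: nonbases of \<open>dual M\<close> are the complements of nonbases of
  \<open>M\<close>, so these are the free elements of \<open>dual M\<close>.\<close>

definition cofree_elements :: "'a indep_system \<Rightarrow> 'a set" where
  "cofree_elements M = {x \<in> ground M. \<forall>W\<in>nonbases M. rank_of M (insert x W) < rank M}"

context matroid
begin

lemma nonbasisI:
  assumes "W \<subseteq> ground M" "card W = rank M" "D \<subseteq> W" "D \<notin> indep M"
  shows "W \<in> nonbases M"
  using assms indep_mono by (auto simp: nonbases_def)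

lemma nonbasis_iff_rank_of:
  "W \<subseteq> ground M \<Longrightarrow> card W = rank M \<Longrightarrow> W \<in> nonbases M \<longleftrightarrow> rank_of M W < rank M"
  using dep_iff_rank_of[of W] finite_ground finite_subset by (auto simp: nonbases_def)

text \<open>Inside a nonbasis there is a dependent set \<open>insert w I\<close> with
  \<open>I\<close> independent. Growing \<open>I\<close> to an independent set of size
  \<open>rank M - 1\<close> and then adding \<open>w\<close> gives the required nonbasis.\<close>

lemma nonbasis_of_corank_1:
  assumes "nonbases M \<noteq> {}"
  obtains W where "W \<in> nonbases M" "Suc (rank_of M W) = rank M"
proof -
  obtain V where V: "V \<in> nonbases M" using assms by auto
  obtain I where I: "I \<in> indep M" "I \<subseteq> V" "card I = rank_of M V" by (rule rank_of_witness)
  have less: "card I < rank M" using I rank_of_nonbasis[OF V] by simp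
  have "I \<noteq> V" using I V by (auto simp: nonbases_def)
  then obtain w where w: "w \<in> V" "w \<notin> I" using I by auto
  have dep: "insert w I \<notin> indep M"
    using card_le_rank_of[of "insert w I" V] I w finite_indep[OF I(1)] by auto
  obtain B where B: "B \<in> bases M" by (rule basis_exists)
  then have "\<exists>J\<in>indep M. I \<subseteq> J \<and> J \<subseteq> I \<union> B \<and> card J = rank M - 1"
    using less by (intro augment_within[OF I(1)]) (auto simp: bases_iff)
  then obtain J where J: "J \<in> indep M" "I \<subseteq> J" "card J = rank M - 1" by auto
  have wJ: "w \<notin> J" using J dep indep_mono[of J "insert w I"] by auto
  let ?W = "insert w J"
  have W: "?W \<in> nonbases M"
  proof (rule nonbasisI[OF _ _ _ dep])
    show "?W \<subseteq> ground M" using J indep_subset[of J] w V by (auto simp: nonbases_def)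
    show "card ?W = rank M" using J wJ less finite_indep by simp
  qed (use J in auto)
  moreover have "rank M - 1 \<le> rank_of M ?W" using card_le_rank_of[OF J(1), of ?W] J by auto
  ultimately show ?thesis using that[of ?W] rank_of_nonbasis[OF W] by simp
qed

text \<open>Trades \<open>s\<close> for an element \<open>y\<close> that spans together with
  \<open>W\<close>. The dependence of \<open>W - {s}\<close> persists, and putting \<open>s\<close>
  back would give full rank, so the rank drops by just one.\<close>

lemma nonbasis_avoiding:
  assumes W: "W \<in> nonbases M" "Suc (rank_of M W) = rank M" and s: "s \<in> W" "W - {s} \<notin> indep M"
  obtains y where "y \<in> ground M - W" "rank_of M (insert y W) = rank M"
    "insert y (W - {s}) \<in> nonbases M" "Suc (rank_of M (insert y (W - {s}))) = rank M"
proof -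
  have Wg: "W \<subseteq> ground M" "card W = rank M" "finite W"
    using W(1) finite_ground finite_subset by (auto simp: nonbases_def)
  obtain y where y: "y \<in> ground M - W" "rank_of M (insert y W) = rank M"
    using rank_of_extend[of W] W(2) by auto
  let ?V = "insert y (W - {s})"
  have V: "?V \<in> nonbases M"
    using y Wg s card_Suc_Diff1[of W s] by (intro nonbasisI[OF _ _ _ s(2)]) auto
  have "insert s ?V = insert y W" using s y by auto
  then have "rank M \<le> Suc (rank_of M ?V)" using rank_of_insert_le[of s ?V] y by simp
  then show ?thesis using that[OF y V] rank_of_nonbasis[OF V] by simp
qed

text \<open>Trades for \<open>s\<close> an element whose removal from the dependent set
  \<open>W\<close> does not change the rank.\<close>

lemma nonbasis_containing:
  assumes W: "W \<in> nonbases M" "Suc (rank_of M W) = rank M"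
    and s: "s \<in> ground M - W" "rank_of M (insert s W) < rank M"
  obtains V where "V \<in> nonbases M" "Suc (rank_of M V) = rank M" "s \<in> V"
proof -
  have Wg: "W \<subseteq> ground M" "card W = rank M" "finite W"
    using W(1) finite_ground finite_subset by (auto simp: nonbases_def)
  have "W \<notin> indep M" using W(1) by (simp add: nonbases_def)
  then obtain w where w: "w \<in> W" "rank_of M (W - {w}) = rank_of M W" using dep_remove Wg(3) by blast
  let ?V = "insert s (W - {w})"
  have le: "rank_of M ?V \<le> rank_of M (insert s W)" by (intro rank_of_mono) auto
  have V: "?V \<subseteq> ground M" "card ?V = rank M" using w s Wg card_Suc_Diff1[of W w] by auto
  then have nb: "?V \<in> nonbases M" using le s by (subst nonbasis_iff_rank_of) auto
  moreover have "rank_of M W \<le> rank_of M ?V"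
    unfolding w(2)[symmetric] by (intro rank_of_mono) auto
  ultimately show ?thesis using that[of ?V] W rank_of_nonbasis[OF nb] by simp
qed

text \<open>Cofreeness of \<open>x\<close> moves it into a nonbasis of corank one, freeness swaps it
  out again for a spanning \<open>y\<close>; the resulting nonbasis together with \<open>x\<close>
  spans, contrary to cofreeness.\<close>

lemma free_cofree_disjoint:
  assumes "nonbases M \<noteq> {}"
  shows "free_elements M \<inter> cofree_elements M = {}"
proof (rule ccontr)
  assume "\<not> ?thesis"
  then obtain x where x: "x \<in> ground M" and fr: "\<And>W. W \<in> nonbases M \<Longrightarrow> W - {x} \<notin> indep M"
    and co: "\<And>W. W \<in> nonbases M \<Longrightarrow> rank_of M (insert x W) < rank M"
    by (auto simp: free_elements_def cofree_elements_def)
  obtain V where V: "V \<in> nonbases M" "Suc (rank_of M V) = rank M"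
    using nonbasis_of_corank_1 assms by blast
  obtain W where W: "W \<in> nonbases M" "Suc (rank_of M W) = rank M" "x \<in> W"
    using nonbasis_containing[OF V, of x] V co x by blast
  obtain y where y: "rank_of M (insert y W) = rank M" "insert y (W - {x}) \<in> nonbases M"
    using nonbasis_avoiding[OF W] fr[OF W(1)] by blast
  have "insert x (insert y (W - {x})) = insert y W" using W by auto
  then show False using co[OF y(2)] y(1) by simp
qed

end

section \<open>Minors of an amplified matroid that copy the original\<close>

text \<open>The smaller of \<open>X2\<close> and \<open>Y2\<close> is matched into the larger one,
  and the remaining elements are matched arbitrarily.\<close>

lemma comparable_bij:
  assumes fin: "finite X1" "finite X2" "finite Y1" "finite Y2"
    and dis: "X1 \<inter> X2 = {}" "Y1 \<inter> Y2 = {}" and card: "card X1 + card X2 = card Y1 + card Y2"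
  obtains h where "bij_betw h (X1 \<union> X2) (Y1 \<union> Y2)" "Y2 \<subseteq> h ` X2 \<or> h ` X2 \<subseteq> Y2"
proof (cases "card Y2 \<le> card X2")
  case True
  then obtain X where X: "X \<subseteq> X2" "card X = card Y2" by (meson obtain_subset_with_card_n)
  have fX: "finite X" using X fin finite_subset by auto
  obtain h1 where h1: "bij_betw h1 X Y2" using finite_same_card_bij fX fin X by blast
  have "card (X1 \<union> (X2 - X)) = card Y1"
    using X fin fX dis card True by (subst card_Un_disjoint) (auto simp: card_Diff_subset)
  then obtain h2 where h2: "bij_betw h2 (X1 \<union> (X2 - X)) Y1"
    using finite_same_card_bij[of "X1 \<union> (X2 - X)" Y1] fin by auto
  let ?h = "\<lambda>x. if x \<in> X then h1 x else h2 x"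
  have "bij_betw ?h (X \<union> (X1 \<union> (X2 - X))) (Y2 \<union> Y1)"
    using X dis by (intro bij_betw_disjoint_Un h1 h2) auto
  moreover have "X \<union> (X1 \<union> (X2 - X)) = X1 \<union> X2" using X by auto
  moreover have "Y2 \<subseteq> ?h ` X2"
  proof -
    have "?h ` X = Y2" using h1 by (auto simp: bij_betw_def)
    then show ?thesis using X(1) by (metis image_mono)
  qed
  ultimately show ?thesis using that[of ?h] by (simp add: Un_commute)
next
  case False
  then obtain Y where Y: "Y \<subseteq> Y2" "card Y = card X2" by (meson obtain_subset_with_card_n linear)
  have fY: "finite Y" using Y fin finite_subset by auto
  obtain h1 where h1: "bij_betw h1 X2 Y" using finite_same_card_bij fY fin Y by metis
  have "card (Y1 \<union> (Y2 - Y)) = card X1"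
    using Y fin fY dis card card_mono[OF fin(4) Y(1)] by (subst card_Un_disjoint) (auto simp: card_Diff_subset)
  then obtain h2 where h2: "bij_betw h2 X1 (Y1 \<union> (Y2 - Y))"
    using finite_same_card_bij[of X1 "Y1 \<union> (Y2 - Y)"] fin by auto
  let ?h = "\<lambda>x. if x \<in> X2 then h1 x else h2 x"
  have "bij_betw ?h (X2 \<union> X1) (Y \<union> (Y1 \<union> (Y2 - Y)))"
    using Y dis by (intro bij_betw_disjoint_Un h1 h2) auto
  moreover have "Y \<union> (Y1 \<union> (Y2 - Y)) = Y1 \<union> Y2" using Y by auto
  moreover have "?h ` X2 = Y" using h1 by (auto simp: bij_betw_def)
  ultimately show ?thesis using that[of ?h] Y(1) by (simp add: Un_commute)
qed

lemma card_partition3: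
  assumes "finite X" "X = X1 \<union> X2 \<union> X3" "X1 \<inter> X2 = {}" "(X1 \<union> X2) \<inter> X3 = {}"
  shows "card X = card X1 + card X2 + card X3"
  using assms by (simp add: card_Un_disjoint)

text \<open>A bijection \<open>g\<close> from \<open>R\<close> to the ground set that fixes the common elements sends nonbases of the
  minor to nonbases of \<open>M\<close>. The two numbers of nonbases agree, so every nonbasis of \<open>M\<close> arises, and this
  constrains \<open>P\<close>; the nonbases of rank one less than full show that \<open>P\<close> misses \<open>B\<close> and covers
  \<open>A - R\<close>.\<close>

lemma (in matroid) amplified_self_minor:
  assumes fin: "finite A" "finite B" and dis: "A \<inter> ground M = {}" "B \<inter> (ground M \<union> A) = {}"
    and PR: "P \<subseteq> ground M \<union> A \<union> B" "R \<subseteq> ground M \<union> A \<union> B" "P \<inter> R = {}"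
    and f: "bij_betw f R (ground M)"
    and iff: "\<And>Z. Z \<subseteq> R \<Longrightarrow> Z \<union> P \<in> amplified M A B \<longleftrightarrow> f ` Z \<in> bases M"
    and ne: "nonbases M \<noteq> {}"
  shows "P \<subseteq> A \<union> cofree_elements M" and "ground M \<union> A \<union> B - P - R \<subseteq> B \<union> free_elements M"
proof -
  define S where "S = ground M"
  define r where "r = rank M"
  \<comment> \<open>\<open>PS\<close> and \<open>QS\<close> are the original elements that are
    contracted and deleted, \<open>RA\<close> and \<open>RB\<close> the added elements standing in
    for them. The numbers \<open>p\<close> and \<open>q\<close> count the elements of
    \<open>B\<close> that are contracted and those of \<open>A\<close> that are deleted; both turn
    out to be zero.\<close>
  define RA RB PS QS where "RA = R \<inter> A" and "RB = R \<inter> B" and "PS = P \<inter> S" and "QS = S - P - R"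
  define p q where "p = card (P \<inter> B)" and "q = card (A - P - R)"
  note S_defs = RA_def RB_def PS_def QS_def
  have finS: "finite S" by (simp add: S_def finite_ground)
  have finP: "finite P" "finite R" using PR fin finite_ground by (auto intro: finite_subset)
  have finite_all: "finite RA" "finite RB" "finite PS" "finite QS" using finP finS by (auto simp: S_defs)
  have dis': "A \<inter> S = {}" "B \<inter> S = {}" "A \<inter> B = {}" using dis by (auto simp: S_def)
  have PR': "P \<subseteq> S \<union> A \<union> B" "R \<subseteq> S \<union> A \<union> B" using PR by (auto simp: S_def)
  have injf: "inj_on f R" and imf: "f ` R = S" using f by (auto simp: bij_betw_def S_def)

  have cardP: "card P = card A"
  proof -
    obtain B0 where B0: "B0 \<in> bases M" by (rule basis_exists)
    then obtain Z where Z: "Z \<subseteq> R" "B0 = f ` Z"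
      using basis_subset[OF B0] imf unfolding S_def by (metis subset_image_iff)
    have "card Z = r" using B0 Z injf by (metis bases_iff card_image inj_on_subset r_def)
    moreover have "card (Z \<union> P) = r + card A" using iff[OF Z(1)] B0 Z by (simp add: amplified_def r_def)
    moreover have "card (Z \<union> P) = card Z + card P"
      using Z PR(3) finP by (intro card_Un_disjoint) (auto intro: finite_subset)
    ultimately show ?thesis by simp
  qed
  have "card RA + card RB = card PS + card QS"
  proof -
    have "card R = card (R \<inter> S) + card RA + card RB"
      using finP PR' dis' unfolding S_defs by (intro card_partition3) auto
    moreover have "card S = card (R \<inter> S) + card PS + card QS"
      using finS PR(3) unfolding S_defs by (intro card_partition3) auto
    moreover have "card R = card S" using bij_betw_same_card[OF f] by (simp add: S_def)
    ultimately show ?thesis by simp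
  qed
  moreover have "card RA + q = card PS + p"
  proof -
    have "card A = card (P \<inter> A) + card RA + q"
      using fin PR(3) unfolding S_defs q_def by (intro card_partition3) auto
    moreover have "card P = card (P \<inter> A) + card PS + p"
      using finP PR' dis' unfolding S_defs p_def by (intro card_partition3) auto
    ultimately show ?thesis using cardP by simp
  qed
  ultimately have cards: "card RA + card RB = card PS + card QS" "card RB + p = card QS + q" by auto

  \<comment> \<open>Comparability makes the difference between the image \<open>G\<close> of
    \<open>RB\<close> and \<open>QS\<close> a genuine set, of size given by \<open>p\<close> and
    \<open>q\<close>.\<close>
  obtain h where h: "bij_betw h (RA \<union> RB) (PS \<union> QS)" "QS \<subseteq> h ` RB \<or> h ` RB \<subseteq> QS"
  proof (rule comparable_bij[OF finite_all _ _ cards(1)])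
    show "RA \<inter> RB = {}" "PS \<inter> QS = {}" using dis' PR(3) by (auto simp: S_defs)
  qed
  define g where "g x = (if x \<in> R \<inter> S then x else h x)" for x
  have g: "bij_betw g R S"
  proof -
    have "bij_betw (\<lambda>x. if x \<in> R \<inter> S then id x else h x) (R \<inter> S \<union> (RA \<union> RB)) (R \<inter> S \<union> (PS \<union> QS))"
      using dis' PR(3) by (intro bij_betw_disjoint_Un h(1) bij_betw_id) (auto simp: S_defs)
    moreover have "R \<inter> S \<union> (RA \<union> RB) = R" "R \<inter> S \<union> (PS \<union> QS) = S" using PR' by (auto simp: S_defs)
    moreover have "(\<lambda>x. if x \<in> R \<inter> S then id x else h x) = g" by (auto simp: g_def)
    ultimately show ?thesis by simp
  qed
  have injg: "inj_on g R" using g by (simp add: bij_betw_def)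
  define G where "G = g ` RB"
  have "g ` RB = h ` RB" using dis' by (intro image_cong) (auto simp: g_def S_defs)
  then have G: "QS \<subseteq> G \<or> G \<subseteq> QS" using h by (simp add: G_def)
  have GPQ: "G \<subseteq> PS \<union> QS"
    using h(1) \<open>g ` RB = h ` RB\<close> by (auto simp: G_def bij_betw_def)
  have cardG: "card G = card RB"
    unfolding G_def using injg by (intro card_image) (auto simp: S_defs intro: inj_on_subset)
  have finG: "finite G" using finite_all by (simp add: G_def)

  \<comment> \<open>These sets correspond to the nonbases of the minor. The given \<open>f\<close>
    serves to count them; the structural information comes from \<open>g\<close>.\<close>
  define \<N> where "\<N> = {Z. Z \<subseteq> R \<and> card Z = r \<and> Z \<union> P \<notin> amplified M A B}"
  have finN: "finite \<N>" using finP by (auto simp: \<N>_def intro: finite_subset[of _ "Pow R"])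
  have "card (nonbases M) = card \<N>"
  proof -
    have "(`) f ` \<N> = nonbases M"
    proof (intro set_eqI iffI)
      fix W assume "W \<in> (`) f ` \<N>"
      then obtain Z where Z: "W = f ` Z" "Z \<subseteq> R" "card Z = r" "Z \<union> P \<notin> amplified M A B"
        by (auto simp: \<N>_def)
      then have "card W = r" using injf by (metis card_image inj_on_subset)
      then show "W \<in> nonbases M" using Z iff[OF Z(2)] imf
        by (auto simp: nonbases_def bases_iff r_def S_def)
    next
      fix W assume W: "W \<in> nonbases M"
      then obtain Z where Z: "Z \<subseteq> R" "W = f ` Z"
        using imf unfolding S_def nonbases_def by (metis (mono_tags, lifting) mem_Collect_eq subset_image_iff)
      then have "card Z = r" using injf W
        by (metis (mono_tags, lifting) card_image inj_on_subset r_def nonbases_def mem_Collect_eq)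
      then show "W \<in> (`) f ` \<N>" using Z iff[OF Z(1)] W by (auto simp: \<N>_def nonbases_def bases_iff)
    qed
    moreover have "inj_on ((`) f) \<N>"
      using inj_on_image_Pow[OF injf] by (rule inj_on_subset) (auto simp: \<N>_def)
    ultimately show ?thesis by (metis card_image)
  qed

  \<comment> \<open>With \<open>W\<close> the image of \<open>Z\<close>, the set
    \<open>Z \<union> P\<close> meets the ground set in \<open>(W - QS) \<union> PS\<close> and
    \<open>B\<close> in \<open>card (W \<inter> G) + p\<close> elements, so not being amplified
    becomes the rank bound \<open>lt\<close>.\<close>
  have key: "g ` Z \<in> nonbases M \<and> g ` Z - QS \<notin> indep M \<and> rank_of M (g ` Z \<union> PS) < r \<and>
      (Suc (rank_of M (g ` Z)) = r \<longrightarrow> card (g ` Z \<inter> QS) = card (g ` Z \<inter> G) + p)"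
    if Z: "Z \<in> \<N>" for Z
  proof -
    define W where "W = g ` Z"
    have ZR: "Z \<subseteq> R" and cZ: "card Z = r" and namp: "Z \<union> P \<notin> amplified M A B"
      using Z by (auto simp: \<N>_def)
    have finZ: "finite Z" using ZR finP finite_subset by auto
    have WS: "W \<subseteq> S" using ZR g by (auto simp: W_def bij_betw_def)
    have finW: "finite W" using WS finS finite_subset by auto
    have cW: "card W = r" unfolding W_def using ZR cZ injg by (metis card_image inj_on_subset)
    have Weq: "W = (Z \<inter> S) \<union> h ` (Z - S)" using ZR by (auto simp: W_def g_def)
    have "h ` (Z - S) \<subseteq> PS \<union> QS"
    proof -
      have "Z - S \<subseteq> RA \<union> RB" using ZR PR' by (auto simp: S_defs)
      then show ?thesis using h(1) by (auto simp: bij_betw_def)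
    qed
    then have Y: "(Z \<union> P) \<inter> S = (W - QS) \<union> PS" using Weq ZR by (auto simp: S_defs)
    have cB: "card ((Z \<union> P) \<inter> B) = card (W \<inter> G) + p"
    proof -
      have "W \<inter> G = g ` (Z \<inter> RB)"
        unfolding W_def G_def using injg ZR by (subst inj_on_image_Int[of g R]) (auto simp: S_defs)
      then have "card (W \<inter> G) = card (Z \<inter> RB)"
        using injg ZR by (metis card_image inj_on_subset le_infI1)
      moreover have "(Z \<union> P) \<inter> B = (Z \<inter> RB) \<union> (P \<inter> B)" using ZR by (auto simp: S_defs)
      moreover have "card ((Z \<inter> RB) \<union> (P \<inter> B)) = card (Z \<inter> RB) + card (P \<inter> B)"
        using finZ finP PR(3) by (intro card_Un_disjoint) (auto simp: S_defs)
      ultimately show ?thesis by (simp add: p_def)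
    qed
    have "card (Z \<union> P) = r + card A"
      using card_Un_disjoint[of Z P] finZ finP ZR PR(3) cZ cardP by auto
    then have lt: "rank_of M ((W - QS) \<union> PS) + (card (W \<inter> G) + p) < r"
      using namp PR ZR unfolding amplified_def cB[symmetric] Y[symmetric] by (auto simp: r_def S_def)
    \<comment> \<open>If \<open>G \<subseteq> QS\<close>, then \<open>QS\<close> exceeds
      \<open>G\<close> by \<open>p - q\<close> elements. Thus returning \<open>W \<inter> QS\<close>
      raises the rank by no more than the slack left in \<open>lt\<close>.\<close>
    have le: "card (W \<inter> QS) \<le> card (W \<inter> G) + p"
      using G
    proof
      assume "QS \<subseteq> G"
      then have "card (W \<inter> QS) \<le> card (W \<inter> G)" using finG by (intro card_mono) auto
      then show ?thesis by simp
    next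
      assume GQ: "G \<subseteq> QS"
      have "card (W \<inter> QS) \<le> card (W \<inter> G) + card (QS - G)"
      proof -
        have "W \<inter> QS \<subseteq> (W \<inter> G) \<union> (QS - G)" by auto
        then have "card (W \<inter> QS) \<le> card ((W \<inter> G) \<union> (QS - G))" using finG finite_all by (intro card_mono) auto
        then show ?thesis using card_Un_le[of "W \<inter> G" "QS - G"] by simp
      qed
      then show ?thesis using card_Diff_subset[OF finG GQ] cardG cards by simp
    qed
    have "rank_of M (W \<union> PS) \<le> rank_of M (((W - QS) \<union> PS) \<union> (W \<inter> QS))" by (intro rank_of_mono) auto
    also have "\<dots> \<le> rank_of M ((W - QS) \<union> PS) + card (W \<inter> QS)" using finW by (intro rank_of_Un_le) auto
    finally have c1: "rank_of M (W \<union> PS) < r" using lt le by linarith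
    have "rank_of M W \<le> rank_of M (W \<union> PS)" by (intro rank_of_mono) auto
    then have c2: "W \<in> nonbases M" using c1 WS cW by (subst nonbasis_iff_rank_of) (auto simp: S_def r_def)
    have m: "rank_of M (W - QS) \<le> rank_of M ((W - QS) \<union> PS)" by (intro rank_of_mono) auto
    have "card (W - QS) + card (W \<inter> QS) = r" using cW card_Int_Diff[OF finW, of QS] by simp
    then have c3: "W - QS \<notin> indep M" using m lt le finW by (subst dep_iff_rank_of) auto
    have "rank_of M W \<le> rank_of M (W - QS) + card (W \<inter> QS)"
      using rank_of_Un_le[of "W \<inter> QS" "W - QS"] finW by (simp add: Un_Diff_Int)
    \<comment> \<open>At corank one the whole chain of inequalities is tight.\<close>
    then have "card (W \<inter> QS) = card (W \<inter> G) + p" if "Suc (rank_of M W) = r"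
      using that lt le m by linarith
    then show ?thesis using c1 c2 c3 by (simp add: W_def)
  qed
  have onto: "(`) g ` \<N> = nonbases M"
  proof (rule card_subset_eq)
    show "finite (nonbases M)" by (rule finite_nonbases)
    show "(`) g ` \<N> \<subseteq> nonbases M" using key by auto
    have "inj_on ((`) g) \<N>"
      using inj_on_image_Pow[OF injg] by (rule inj_on_subset) (auto simp: \<N>_def)
    then show "card ((`) g ` \<N>) = card (nonbases M)" using \<open>card (nonbases M) = card \<N>\<close> by (simp add: card_image)
  qed
  have F1: "W - QS \<notin> indep M" and F2: "rank_of M (W \<union> PS) < r"
    and F3: "Suc (rank_of M W) = r \<Longrightarrow> card (W \<inter> QS) = card (W \<inter> G) + p" if "W \<in> nonbases M" for W
  proof -
    obtain Z where "Z \<in> \<N>" "W = g ` Z" using \<open>W \<in> nonbases M\<close> onto by blast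
    then show "W - QS \<notin> indep M" "rank_of M (W \<union> PS) < r"
      "Suc (rank_of M W) = r \<Longrightarrow> card (W \<inter> QS) = card (W \<inter> G) + p" using key by simp_all
  qed

  have "PS \<subseteq> cofree_elements M"
  proof
    fix x assume x: "x \<in> PS"
    have "rank_of M (insert x W) < rank M" if "W \<in> nonbases M" for W
      using F2[OF that] rank_of_mono[of "insert x W" "W \<union> PS"] x by (simp add: r_def)
    then show "x \<in> cofree_elements M" using x by (auto simp: cofree_elements_def S_defs S_def)
  qed
  moreover have "QS \<subseteq> free_elements M"
  proof
    fix x assume x: "x \<in> QS"
    have "W - {x} \<notin> indep M" if "W \<in> nonbases M" for W
      using F1[OF that] indep_mono[of "W - {x}" "W - QS"] x by auto
    then show "x \<in> free_elements M" using x by (auto simp: free_elements_def S_defs S_def)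
  qed
  moreover have "p = 0 \<and> q = 0"
  proof -
    obtain W where W: "W \<in> nonbases M" "Suc (rank_of M W) = r"
      using nonbasis_of_corank_1[OF ne] by (auto simp: r_def)
    have finW: "finite V" if "V \<in> nonbases M" for V
      using that finite_ground finite_subset by (auto simp: nonbases_def)
    show ?thesis
      using G
    proof
      \<comment> \<open>Here \<open>F3\<close> forces \<open>p = 0\<close> and keeps every
        corank-one nonbasis away from \<open>G - QS\<close>. If \<open>q\<close> were positive, that
        set would contain an element of \<open>PS\<close>, which \<open>F2\<close> and
        \<open>nonbasis_containing\<close> bring into such a nonbasis.\<close>
      assume QG: "QS \<subseteq> G"
      have *: "p = 0 \<and> V \<inter> (G - QS) = {}" if V: "V \<in> nonbases M" "Suc (rank_of M V) = r" for V
      proof -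
        have "V \<inter> G = (V \<inter> QS) \<union> (V \<inter> (G - QS))" using QG by auto
        then have "card (V \<inter> G) = card (V \<inter> QS) + card (V \<inter> (G - QS))"
          using card_Un_disjoint[of "V \<inter> QS" "V \<inter> (G - QS)"] finW[OF V(1)] by auto
        then show ?thesis using F3[OF V] finW[OF V(1)] by auto
      qed
      have "q = 0"
      proof (rule ccontr)
        assume "q \<noteq> 0"
        then have "card QS < card G" using cards cardG *[OF W] by simp
        then obtain s where s: "s \<in> G - QS" using QG by (metis Diff_iff psubsetI less_irrefl subsetI subset_antisym)
        then have sP: "s \<in> PS" using GPQ by auto
        have "rank_of M (insert s W) < rank M"
          using F2[OF W(1)] rank_of_mono[of "insert s W" "W \<union> PS"] sP by (simp add: r_def)
        moreover have "s \<in> ground M - W" using *[OF W] s sP by (auto simp: S_defs S_def)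
        ultimately obtain V where "V \<in> nonbases M" "Suc (rank_of M V) = rank M" "s \<in> V"
          using nonbasis_containing[OF W(1)] W(2) unfolding r_def by blast
        then show False using *[of V] s by (auto simp: r_def)
      qed
      then show ?thesis using *[OF W] by simp
    next
      \<comment> \<open>Here \<open>F3\<close> forces \<open>q = 0\<close> and puts
        \<open>QS - G\<close> inside every corank-one nonbasis. If \<open>p\<close> were positive,
        \<open>F1\<close> and \<open>nonbasis_avoiding\<close> would swap out one of its
        elements.\<close>
      assume GQ: "G \<subseteq> QS"
      have cQG: "card (QS - G) + q = p"
        using card_Diff_subset[OF finG GQ] card_mono[OF finite_all(4) GQ] cards cardG by simp
      have *: "q = 0 \<and> QS - G \<subseteq> V" if V: "V \<in> nonbases M" "Suc (rank_of M V) = r" for V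
      proof -
        have "V \<inter> QS = (V \<inter> G) \<union> (V \<inter> (QS - G))" using GQ by auto
        then have "card (V \<inter> QS) = card (V \<inter> G) + card (V \<inter> (QS - G))"
          using card_Un_disjoint[of "V \<inter> G" "V \<inter> (QS - G)"] finW[OF V(1)] by auto
        then have e: "card (V \<inter> (QS - G)) = p" using F3[OF V] by simp
        have "card (V \<inter> (QS - G)) \<le> card (QS - G)" using finite_all by (intro card_mono) auto
        then have "q = 0" "card (V \<inter> (QS - G)) = card (QS - G)" using e cQG by auto
        moreover from this have "V \<inter> (QS - G) = QS - G" using finite_all by (intro card_subset_eq) auto
        ultimately show ?thesis by auto
      qed
      have "p = 0"
      proof (rule ccontr)
        assume "p \<noteq> 0"
        then have "card (QS - G) \<noteq> 0" using cQG *[OF W] by simp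
        then obtain s where s: "s \<in> QS - G" by (metis card.empty ex_in_conv)
        have "W - {s} \<notin> indep M" using F1[OF W(1)] indep_mono[of "W - {s}" "W - QS"] s by auto
        then obtain y where "y \<in> ground M - W" "insert y (W - {s}) \<in> nonbases M"
          "Suc (rank_of M (insert y (W - {s}))) = rank M"
          using nonbasis_avoiding[OF W(1), of s] W(2) *[OF W] s unfolding r_def by blast
        then show False using *[of "insert y (W - {s})"] s *[OF W] by (auto simp: r_def)
      qed
      then show ?thesis using *[OF W] by simp
    qed
  qed
  then have "P \<inter> B = {}" "A - P - R = {}" using finP fin by (auto simp: p_def q_def)
  ultimately show "P \<subseteq> A \<union> cofree_elements M" "ground M \<union> A \<union> B - P - R \<subseteq> B \<union> free_elements M"
    using PR' by (auto simp: S_defs S_def)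
qed

section \<open>Merging two amplified matroids\<close>

definition nonamplified :: "'a indep_system \<Rightarrow> 'a set \<Rightarrow> 'a set \<Rightarrow> 'a set set" where
  "nonamplified M A B = {X. X \<subseteq> ground M \<union> A \<union> B \<and> card X = rank M + card A \<and> X \<notin> amplified M A B}"

text \<open>Every exchange of one element of \<open>W\<close> for one outside gives a basis. So
  proper subsets of \<open>W\<close> are independent and every further element raises the
  rank.\<close>

lemma (in matroid) unique_nonbasis:
  assumes W: "W \<in> nonbases M" and uniq: "\<And>V. V \<in> nonbases M \<Longrightarrow> V = W" and pos: "rank M > 0"
  shows "W \<in> circuit_hyperplanes M"
proof -
  have Wg: "W \<subseteq> ground M" "card W = rank M" "W \<notin> indep M" "finite W"
    using W finite_ground finite_subset by (auto simp: nonbases_def)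
  have swap: "insert y (W - {w}) \<in> bases M" if "w \<in> W" "y \<in> ground M - W" for w y
  proof -
    have "card (insert y (W - {w})) = rank M" using that Wg card_Suc_Diff1[of W w] by auto
    moreover have "insert y (W - {w}) \<noteq> W" using that by auto
    ultimately show ?thesis using uniq that Wg by (subst bases_iff_nonbases) auto
  qed
  obtain y where y: "y \<in> ground M - W" using rank_of_extend[OF rank_of_nonbasis[OF W]] by blast
  have proper: "D \<in> indep M" if "D \<subset> W" for D
  proof -
    obtain w where "w \<in> W" "D \<subseteq> W - {w}" using \<open>D \<subset> W\<close> by blast
    then show ?thesis using swap[of w y] y indep_mono[of "insert y (W - {w})" D] by (auto simp: bases_iff)
  qed
  then have "W \<in> circuits M" using Wg by (simp add: circuits_def)
  moreover have "W \<in> hyperplanes M"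
  proof -
    obtain w where w: "w \<in> W" using Wg pos by fastforce
    have "rank_of M W < rank_of M (insert e W)" if "e \<in> ground M - W" for e
    proof -
      have "insert e (W - {w}) \<in> bases M" using swap[OF w that] .
      then have "rank M \<le> rank_of M (insert e W)"
        using card_le_rank_of[of "insert e (W - {w})" "insert e W"] by (auto simp: bases_iff)
      then show ?thesis using rank_of_nonbasis[OF W] by simp
    qed
    then have "W \<in> flats M" using Wg by (simp add: flats_def)
    moreover have "W - {w} \<in> indep M" using w by (intro proper) auto
    then have "card (W - {w}) \<le> rank_of M W" by (intro card_le_rank_of) auto
    then have "Suc (rank_of M W) = rank M" using rank_of_nonbasis[OF W] w Wg by simp
    ultimately show ?thesis by (simp add: hyperplanes_def)
  qed
  ultimately show ?thesis by (simp add: circuit_hyperplanes_def)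
qed

lemma ex_fresh_subset:
  fixes X :: "'a :: infinite set"
  assumes "finite X"
  obtains Y where "finite Y" "card Y = n" "Y \<inter> X = {}"
proof -
  have "infinite (UNIV - X)" using assms infinite_UNIV by (rule Diff_infinite_finite)
  from infinite_arbitrarily_large[OF this, of n] show ?thesis using that by blast
qed

text \<open>A matroid without nonbases is uniform. After free coextension by \<open>rank N\<close>
  elements and free extension by \<open>P\<close> and \<open>R\<close>, the \<open>rank M\<close>
  elements of \<open>P\<close> alone satisfy the amplified inequality, so contracting
  \<open>P\<close> and restricting to \<open>R\<close> leaves a uniform matroid of rank
  \<open>rank N\<close>.\<close>

lemma uniform_obtainable:
  fixes M N :: "'a :: infinite indep_system"
  assumes "matroid M" "matroid N" and uni: "nonbases N = {}"
  shows "\<exists>N'. obtainable M N' \<and> isomorphic N' N"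
proof -
  interpret M: matroid M by fact
  interpret N: matroid N by fact
  obtain A where A: "finite A" "card A = rank N" "A \<inter> ground M = {}"
    using M.finite_ground by (rule ex_fresh_subset)
  have "finite (ground M \<union> A)" using A M.finite_ground by simp
  then obtain P where P: "finite P" "card P = rank M" "P \<inter> (ground M \<union> A) = {}"
    by (rule ex_fresh_subset)
  have "finite (ground M \<union> A \<union> P)" using A P M.finite_ground by simp
  then obtain R where R: "finite R" "card R = card (ground N)" "R \<inter> (ground M \<union> A \<union> P) = {}"
    by (rule ex_fresh_subset)
  have d: "A \<inter> ground M = {}" "(P \<union> R) \<inter> (ground M \<union> A) = {}" "finite (P \<union> R)"
    using A P R by auto
  obtain L where L: "obtainable M L" "matroid L" "ground L = ground M \<union> A \<union> (P \<union> R)"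
    "bases L = amplified M A (P \<union> R)"
    using M.amplified_extension[OF A(1) d(1) d(3,2)] by auto
  interpret L: matroid L by fact
  obtain f where f: "bij_betw f R (ground N)"
    using finite_same_card_bij[OF R(1) N.finite_ground R(2)] by auto
  have b: "Z \<union> P \<in> bases L \<longleftrightarrow> card Z = rank N" if "Z \<subseteq> R" for Z
  proof -
    have "card (Z \<union> P) = card Z + rank M"
      using that P R finite_subset[OF that] card_Un_disjoint[of Z P] by auto
    moreover have "rank M \<le> card ((Z \<union> P) \<inter> (P \<union> R))"
      using P R that finite_subset[OF that R(1)]
      by (subst P(2)[symmetric]) (intro card_mono, auto)
    ultimately show ?thesis using that L(4) A by (auto simp: amplified_def)
  qed
  have b': "f ` Z \<in> bases N \<longleftrightarrow> card Z = rank N" if "Z \<subseteq> R" for Z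
  proof -
    have "inj_on f Z" "f ` Z \<subseteq> ground N" using f that by (auto simp: bij_betw_def intro: inj_on_subset)
    moreover from this have "card (f ` Z) = card Z" by (simp add: card_image)
    ultimately show ?thesis using uni N.bases_iff_nonbases[of "f ` Z"] by (auto simp: N.bases_iff)
  qed
  have "rank N \<le> card R"
    using N.rank_of_le_card[OF N.finite_ground] R by (simp add: rank_def)
  then obtain Z0 where "Z0 \<subseteq> R" "card Z0 = rank N" by (meson obtain_subset_with_card_n)
  then obtain N' where N': "is_minor N' L" "matroid N'" "ground N' = R"
    "bases N' = {Z. Z \<subseteq> R \<and> Z \<union> P \<in> bases L}"
    using L.minor_exists[of P R Z0] b P R L by blast
  have "isomorphic N' N"
    using N' f b b' by (intro isomorphicI[where f = f] assms) auto
  then show ?thesis using obtainable.minor[OF L(1) N'(1)] by blast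
qed

lemma card_Diff_swap:
  "finite X \<Longrightarrow> finite Y \<Longrightarrow> card X = card Y \<Longrightarrow> card (X - Y) = card (Y - X)"
  using card_Int_Diff[of X Y] card_Int_Diff[of Y X] by (simp add: Int_commute)

text \<open>Contracting \<open>A\<^sub>i\<close> and deleting \<open>B\<^sub>i\<close> recovers \<open>M\<^sub>i\<close>. Placing the free elements of \<open>M\<^sub>1\<close> in \<open>A\<^sub>2\<close>
  (and so the cofree ones in \<open>B\<^sub>2\<close>), and symmetrically, makes the merged matroid minimal.\<close>

locale merge =
  fixes M\<^sub>1 M\<^sub>2 :: "'a :: infinite indep_system" and A\<^sub>1 B\<^sub>1 A\<^sub>2 B\<^sub>2 E :: "'a set" and \<H> :: "'a set set"
    and k d :: nat
  assumes M1: "matroid M\<^sub>1" and M2: "matroid M\<^sub>2"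
    and pos1: "rank M\<^sub>1 > 0" and pos2: "rank M\<^sub>2 > 0"
    and disjoint_grounds: "ground M\<^sub>1 \<inter> ground M\<^sub>2 = {}"
    and not_obtainable1: "\<not> (\<exists>N. obtainable M\<^sub>2 N \<and> isomorphic N M\<^sub>1)"
    and not_obtainable2: "\<not> (\<exists>N. obtainable M\<^sub>1 N \<and> isomorphic N M\<^sub>2)"
    and no_ch1: "circuit_hyperplanes M\<^sub>1 = {}" and no_ch2: "circuit_hyperplanes M\<^sub>2 = {}"
    and fin1: "finite A\<^sub>1" "finite B\<^sub>1" and fin2: "finite A\<^sub>2" "finite B\<^sub>2"
    and dis1: "A\<^sub>1 \<inter> ground M\<^sub>1 = {}" "B\<^sub>1 \<inter> (ground M\<^sub>1 \<union> A\<^sub>1) = {}"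
    and dis2: "A\<^sub>2 \<inter> ground M\<^sub>2 = {}" "B\<^sub>2 \<inter> (ground M\<^sub>2 \<union> A\<^sub>2) = {}"
    and E1: "E = ground M\<^sub>1 \<union> A\<^sub>1 \<union> B\<^sub>1" and E2: "E = ground M\<^sub>2 \<union> A\<^sub>2 \<union> B\<^sub>2"
    and k1: "k = rank M\<^sub>1 + card A\<^sub>1" and k2: "k = rank M\<^sub>2 + card A\<^sub>2"
    and AA: "A\<^sub>1 \<inter> A\<^sub>2 = {}" and BB: "B\<^sub>1 \<inter> B\<^sub>2 = {}"
    and free1: "A\<^sub>2 \<inter> ground M\<^sub>1 = free_elements M\<^sub>1" and free2: "A\<^sub>1 \<inter> ground M\<^sub>2 = free_elements M\<^sub>2"
    and d1: "rank M\<^sub>1 \<le> d" and d2: "rank M\<^sub>2 \<le> d"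
    and H: "\<And>H. H \<in> \<H> \<Longrightarrow> H \<subseteq> E \<and> card H = k"
    and far: "\<And>X Y. X \<in> nonamplified M\<^sub>1 A\<^sub>1 B\<^sub>1 \<Longrightarrow> Y \<in> nonamplified M\<^sub>2 A\<^sub>2 B\<^sub>2 \<Longrightarrow> d < card (X - Y)"
    and far1: "\<And>H X. H \<in> \<H> \<Longrightarrow> X \<in> nonamplified M\<^sub>1 A\<^sub>1 B\<^sub>1 \<Longrightarrow> d < card (H - X)"
    and far2: "\<And>H X. H \<in> \<H> \<Longrightarrow> X \<in> nonamplified M\<^sub>2 A\<^sub>2 B\<^sub>2 \<Longrightarrow> d < card (H - X)"
    and farH: "\<And>H G. H \<in> \<H> \<Longrightarrow> G \<in> \<H> \<Longrightarrow> H \<noteq> G \<Longrightarrow> d < card (H - G)"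
    and core1: "\<And>Z. Z \<subseteq> ground M\<^sub>1 \<Longrightarrow> card Z = rank M\<^sub>1 \<Longrightarrow> Z \<union> A\<^sub>1 \<in> amplified M\<^sub>2 A\<^sub>2 B\<^sub>2 - \<H>"
    and core2: "\<And>Z. Z \<subseteq> ground M\<^sub>2 \<Longrightarrow> card Z = rank M\<^sub>2 \<Longrightarrow> Z \<union> A\<^sub>2 \<in> amplified M\<^sub>1 A\<^sub>1 B\<^sub>1 - \<H>"
begin

section \<open>The merged matroid and its two minors\<close>

sublocale M1: matroid M\<^sub>1 by (rule M1)
sublocale M2: matroid M\<^sub>2 by (rule M2)

text \<open>Taking out a member of \<open>\<H>\<close> reverses the relaxation of a
  circuit-hyperplane: being far from all other nonbases, it becomes a circuit-hyperplane.\<close>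

definition merged_bases :: "'a set set" where
  "merged_bases = amplified M\<^sub>1 A\<^sub>1 B\<^sub>1 \<inter> amplified M\<^sub>2 A\<^sub>2 B\<^sub>2 - \<H>"

lemma finite_E: "finite E"
  using E1 fin1 M1.finite_ground by simp

text \<open>Makes every statement about \<open>M\<^sub>1\<close> available for
  \<open>M\<^sub>2\<close>. The distance between \<open>k\<close>-sets is symmetric because the two
  differences have equal size.\<close>

lemma swap: "merge M\<^sub>2 M\<^sub>1 A\<^sub>2 B\<^sub>2 A\<^sub>1 B\<^sub>1 E \<H> k d"
proof -
  have far': "d < card (X - Y)"
    if X: "X \<in> nonamplified M\<^sub>2 A\<^sub>2 B\<^sub>2" and Y: "Y \<in> nonamplified M\<^sub>1 A\<^sub>1 B\<^sub>1" for X Y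
  proof -
    have "X \<subseteq> E" "Y \<subseteq> E" "card X = card Y"
      using X Y k1 k2 E1 E2 by (auto simp: nonamplified_def)
    then show ?thesis using far[OF Y X] card_Diff_swap[of X Y] finite_E by (simp add: finite_subset)
  qed
  have comm: "ground M\<^sub>2 \<inter> ground M\<^sub>1 = {}" "A\<^sub>2 \<inter> A\<^sub>1 = {}" "B\<^sub>2 \<inter> B\<^sub>1 = {}"
    using disjoint_grounds AA BB by auto
  show ?thesis
    by (rule merge.intro; fact M1 M2 pos1 pos2 comm not_obtainable1 not_obtainable2 no_ch1 no_ch2
        fin1 fin2 dis1 dis2 E1 E2 k1 k2 free1 free2 d1 d2 H far' far1 far2 farH core1 core2)
qed

lemma not_merged_basis:
  assumes "X \<subseteq> E" "card X = k"
  shows "X \<notin> merged_bases \<longleftrightarrow> X \<in> nonamplified M\<^sub>1 A\<^sub>1 B\<^sub>1 \<or> X \<in> nonamplified M\<^sub>2 A\<^sub>2 B\<^sub>2 \<or> X \<in> \<H>"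
  using assms k1 k2 E1 E2 by (auto simp: merged_bases_def nonamplified_def)

lemma merged_basis: "X \<in> merged_bases \<Longrightarrow> X \<subseteq> E \<and> card X = k"
  using k1 E1 by (auto simp: merged_bases_def amplified_def)

text \<open>The three kinds of nonbases are more than \<open>d\<close> apart, as are distinct
  members of \<open>\<H>\<close>; hence the kind of one nonbasis fixes that of all nonbases within
  distance \<open>d\<close>.\<close>

lemma close_nonbases:
  assumes X: "X \<subseteq> E" "card X = k" "X \<notin> merged_bases" and Y: "Y \<subseteq> E" "card Y = k" "Y \<notin> merged_bases"
    and close: "card (X - Y) \<le> d"
  shows "X \<in> nonamplified M\<^sub>1 A\<^sub>1 B\<^sub>1 \<Longrightarrow> Y \<in> nonamplified M\<^sub>1 A\<^sub>1 B\<^sub>1"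
    and "X \<in> nonamplified M\<^sub>2 A\<^sub>2 B\<^sub>2 \<Longrightarrow> Y \<in> nonamplified M\<^sub>2 A\<^sub>2 B\<^sub>2"
    and "X \<in> \<H> \<Longrightarrow> Y = X"
proof -
  have "card (Y - X) \<le> d"
    using close card_Diff_swap[of X Y] X Y finite_E by (simp add: finite_subset)
  then have *: "\<not> d < card (X - Y)" "\<not> d < card (Y - X)" using close by auto
  note cases = not_merged_basis[OF Y(1,2)] Y(3)
  show "X \<in> nonamplified M\<^sub>1 A\<^sub>1 B\<^sub>1 \<Longrightarrow> Y \<in> nonamplified M\<^sub>1 A\<^sub>1 B\<^sub>1"
    using cases * far far1 by blast
  show "X \<in> nonamplified M\<^sub>2 A\<^sub>2 B\<^sub>2 \<Longrightarrow> Y \<in> nonamplified M\<^sub>2 A\<^sub>2 B\<^sub>2"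
    using cases * far far2 by blast
  show "X \<in> \<H> \<Longrightarrow> Y = X"
    using cases * far1 far2 farH by blast
qed

lemma ex_amplified1:
  "\<exists>N. obtainable M\<^sub>1 N \<and> matroid N \<and> ground N = E \<and> bases N = amplified M\<^sub>1 A\<^sub>1 B\<^sub>1"
  using M1.amplified_extension fin1 dis1 by (simp add: E1)

lemma ex_amplified2:
  "\<exists>N. obtainable M\<^sub>2 N \<and> matroid N \<and> ground N = E \<and> bases N = amplified M\<^sub>2 A\<^sub>2 B\<^sub>2"
  using M2.amplified_extension fin2 dis2 by (simp add: E2)

text \<open>Adding \<open>A\<^sub>1\<close> leaves just the rank condition of
  \<open>M\<^sub>1\<close>, while \<open>core1\<close> ensures that neither the second family nor
  \<open>\<H>\<close> interferes.\<close>

lemma core_basis1: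
  assumes "Z \<subseteq> ground M\<^sub>1"
  shows "Z \<union> A\<^sub>1 \<in> merged_bases \<longleftrightarrow> Z \<in> bases M\<^sub>1"
proof -
  have fZ: "finite Z" using assms M1.finite_ground finite_subset by auto
  have "card (Z \<union> A\<^sub>1) = card Z + card A\<^sub>1"
    using fZ fin1 assms dis1 by (intro card_Un_disjoint) auto
  moreover have "(Z \<union> A\<^sub>1) \<inter> ground M\<^sub>1 = Z" "(Z \<union> A\<^sub>1) \<inter> B\<^sub>1 = {}" using assms dis1 by auto
  ultimately have "Z \<union> A\<^sub>1 \<in> amplified M\<^sub>1 A\<^sub>1 B\<^sub>1 \<longleftrightarrow> card Z = rank M\<^sub>1 \<and> rank M\<^sub>1 \<le> rank_of M\<^sub>1 Z"
    using assms by (auto simp: amplified_def)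
  also have "\<dots> \<longleftrightarrow> Z \<in> bases M\<^sub>1"
    using M1.rank_of_le_rank[of Z] M1.indep_iff_rank_of[OF fZ] by (auto simp: M1.bases_iff)
  finally show ?thesis using core1[OF assms] by (auto simp: merged_bases_def M1.bases_iff)
qed

text \<open>If every exchange fails, the failing sets differ pairwise in at most one element, so
  they are all of one kind. The first two kinds contradict exchange in the corresponding amplified
  matroid.\<close>

lemma matroid_merged: "matroid (spread E merged_bases)"
proof (rule matroid_spread)
  obtain B where "B \<in> bases M\<^sub>1" by (rule M1.basis_exists)
  then show "merged_bases \<noteq> {}" using core_basis1[of B] M1.basis_subset by auto
  fix X Y x assume X: "X \<in> merged_bases" and Y: "Y \<in> merged_bases" and x: "x \<in> X - Y"
  let ?X = "\<lambda>y. insert y (X - {x})"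
  note XY = merged_basis[OF X] merged_basis[OF Y]
  have fin: "finite X" "finite Y" using XY finite_E finite_subset by auto
  show "\<exists>y\<in>Y - X. ?X y \<in> merged_bases"
  proof (rule ccontr)
    assume "\<not> ?thesis"
    then have non: "?X y \<notin> merged_bases" if "y \<in> Y - X" for y using that by blast
    have sub: "?X y \<subseteq> E" "card (?X y) = k" if "y \<in> Y - X" for y
      using that XY x fin card_Suc_Diff1[of X x] by auto
    have close: "card (?X y - ?X z) \<le> d" for y z
    proof -
      have "card (?X y - ?X z) \<le> card {y}" by (intro card_mono) auto
      then show ?thesis using d1 pos1 by simp
    qed
    have "\<not> Y \<subseteq> X" using x XY fin card_subset_eq[of X Y] by auto
    then obtain y where y: "y \<in> Y - X" by auto
    consider "?X y \<in> nonamplified M\<^sub>1 A\<^sub>1 B\<^sub>1" | "?X y \<in> nonamplified M\<^sub>2 A\<^sub>2 B\<^sub>2" | "?X y \<in> \<H>"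
      using not_merged_basis[OF sub[OF y]] non[OF y] by blast
    then show False
    proof cases
      case 1
      obtain N where N: "matroid N" "bases N = amplified M\<^sub>1 A\<^sub>1 B\<^sub>1" using ex_amplified1 by auto
      obtain z where z: "z \<in> Y - X" "?X z \<in> amplified M\<^sub>1 A\<^sub>1 B\<^sub>1"
        using matroid.basis_exchange[OF N(1), of X Y x] X Y x N(2) by (auto simp: merged_bases_def)
      then show False
        using close_nonbases(1)[OF sub[OF y] non[OF y] sub[OF z(1)] non[OF z(1)] close 1]
        by (simp add: nonamplified_def)
    next
      case 2
      obtain N where N: "matroid N" "bases N = amplified M\<^sub>2 A\<^sub>2 B\<^sub>2" using ex_amplified2 by auto
      obtain z where z: "z \<in> Y - X" "?X z \<in> amplified M\<^sub>2 A\<^sub>2 B\<^sub>2"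
        using matroid.basis_exchange[OF N(1), of X Y x] X Y x N(2) by (auto simp: merged_bases_def)
      then show False
        using close_nonbases(2)[OF sub[OF y] non[OF y] sub[OF z(1)] non[OF z(1)] close 2]
        by (simp add: nonamplified_def)
    next
      case 3
      \<comment> \<open>All failing sets coincide with one member of \<open>\<H>\<close>, so
        \<open>y\<close> is the only element of \<open>Y - X\<close> and \<open>Y\<close> itself is
        that removed set.\<close>
      have "z = y" if z: "z \<in> Y - X" for z
        using close_nonbases(3)[OF sub[OF y] non[OF y] sub[OF z] non[OF z] close 3] y z by blast
      then have "Y \<subseteq> ?X y" using x by blast
      then have "Y = ?X y" using sub[OF y] XY fin by (intro card_subset_eq) auto
      then show False using 3 Y by (simp add: merged_bases_def)
    qed
  qed
qed (use finite_E merged_basis in auto)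

lemma bases_merged: "bases (spread E merged_bases) = merged_bases"
  using merged_basis finite_E finite_subset by (intro bases_spread[where k = k]) blast

lemma rank_merged: "rank (spread E merged_bases) = k"
proof -
  obtain B where "B \<in> bases (spread E merged_bases)" using matroid.basis_exists[OF matroid_merged] by blast
  then show ?thesis
    using matroid.bases_iff[OF matroid_merged, of B] merged_basis[of B] by (simp add: bases_merged)
qed

lemma has_minor1: "has_minor_iso (spread E merged_bases) M\<^sub>1"
proof -
  interpret M: matroid "spread E merged_bases" by (rule matroid_merged)
  obtain B where B: "B \<in> bases M\<^sub>1" by (rule M1.basis_exists)
  have "A\<^sub>1 \<subseteq> E" "ground M\<^sub>1 \<subseteq> E" "A\<^sub>1 \<inter> ground M\<^sub>1 = {}" using E1 dis1 by auto
  moreover have "B \<union> A\<^sub>1 \<in> merged_bases" using core_basis1 M1.basis_subset[OF B] B by blast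
  ultimately obtain N where N: "is_minor N (spread E merged_bases)" "matroid N" "ground N = ground M\<^sub>1"
    "bases N = {Z. Z \<subseteq> ground M\<^sub>1 \<and> Z \<union> A\<^sub>1 \<in> bases (spread E merged_bases)}"
    using M.minor_exists[of A\<^sub>1 "ground M\<^sub>1" B thesis] M1.basis_subset[OF B]
    by (simp add: bases_merged)
  note N = N[unfolded bases_merged]
  have "isomorphic N M\<^sub>1"
    using N core_basis1 M1 by (intro isomorphicI[where f = id]) auto
  then show ?thesis using N(1) by (auto simp: has_minor_iso_def)
qed

section \<open>Locating the minors and minimality\<close>

lemma nonuniform1: "nonbases M\<^sub>1 \<noteq> {}"
  using uniform_obtainable[OF M2 M1] not_obtainable1 by blast

text \<open>The bases of the minor differ pairwise by at most \<open>d\<close> elements, so its nonbases come from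
  a single one of the three mutually distant families of nonbases of the merged matroid.\<close>

lemma minor_is_amplified_minor1:
  assumes PR: "P \<subseteq> E" "R \<subseteq> E" "P \<inter> R = {}" and f: "bij_betw f R (ground M\<^sub>1)"
    and iff: "\<And>Z. Z \<subseteq> R \<Longrightarrow> Z \<union> P \<in> merged_bases \<longleftrightarrow> f ` Z \<in> bases M\<^sub>1" and Z: "Z \<subseteq> R"
  shows "Z \<union> P \<in> amplified M\<^sub>1 A\<^sub>1 B\<^sub>1 \<longleftrightarrow> f ` Z \<in> bases M\<^sub>1"
proof (rule ccontr)
  assume contra: "\<not> ?thesis"
  have injf: "inj_on f R" and imf: "f ` R = ground M\<^sub>1" using f by (auto simp: bij_betw_def)
  have finPR: "finite P" "finite R" using PR finite_E by (auto intro: finite_subset)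
  have cardf: "card (f ` Z) = card Z" if "Z \<subseteq> R" for Z using injf that by (metis card_image inj_on_subset)
  have cardU: "card (Z \<union> P) = card Z + card P" if "Z \<subseteq> R" for Z
    using that finPR PR(3) finite_subset[OF that] by (intro card_Un_disjoint) auto
  have cardP: "rank M\<^sub>1 + card P = k"
  proof -
    obtain B0 where B0: "B0 \<in> bases M\<^sub>1" by (rule M1.basis_exists)
    then obtain Z0 where Z0: "Z0 \<subseteq> R" "B0 = f ` Z0"
      using M1.basis_subset[OF B0] imf by (metis subset_image_iff)
    then show ?thesis
      using B0 iff[of Z0] merged_basis[of "Z0 \<union> P"] cardU[of Z0] cardf[of Z0] by (simp add: M1.bases_iff)
  qed
  have sub: "V \<union> P \<subseteq> E" "card (V \<union> P) = k" if "V \<subseteq> R" "card V = rank M\<^sub>1" for V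
    using that PR cardU cardP by auto
  have close: "card ((V \<union> P) - (W \<union> P)) \<le> d" if V: "V \<subseteq> R" "card V = rank M\<^sub>1" for V W
  proof -
    have "card ((V \<union> P) - (W \<union> P)) \<le> card V"
      using finite_subset[OF V(1) finPR(2)] by (intro card_mono) auto
    then show ?thesis using V d1 by simp
  qed
  have "card Z = rank M\<^sub>1"
    using contra cardU[OF Z] cardf[OF Z] cardP k1 by (auto simp: amplified_def M1.bases_iff)
  note Z = Z this
  have amp: "Z \<union> P \<in> amplified M\<^sub>1 A\<^sub>1 B\<^sub>1" and nbZ: "f ` Z \<notin> bases M\<^sub>1"
    using contra iff[OF Z(1)] by (auto simp: merged_bases_def)
  then have non: "Z \<union> P \<notin> merged_bases" using iff[OF Z(1)] by simp
  have nonbasis_preimage: "\<exists>V. V \<subseteq> R \<and> card V = rank M\<^sub>1 \<and> W = f ` V \<and> V \<union> P \<notin> merged_bases"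
    if "W \<in> nonbases M\<^sub>1" for W
  proof -
    have "W \<subseteq> f ` R" "card W = rank M\<^sub>1" "W \<notin> bases M\<^sub>1"
      using that imf by (auto simp: nonbases_def M1.bases_iff)
    then show ?thesis using cardf iff by (metis subset_image_iff)
  qed
  consider "Z \<union> P \<in> nonamplified M\<^sub>2 A\<^sub>2 B\<^sub>2" | "Z \<union> P \<in> \<H>"
    using not_merged_basis[OF sub[OF Z]] non amp by (auto simp: nonamplified_def)
  then show False
  proof cases
    case 1
    \<comment> \<open>All nonbases of the minor are of the second kind, so the same \<open>P\<close>
      and \<open>R\<close> cut a copy of \<open>M\<^sub>1\<close> out of the amplified
      \<open>M\<^sub>2\<close>.\<close>
    have iff2: "V \<union> P \<in> amplified M\<^sub>2 A\<^sub>2 B\<^sub>2 \<longleftrightarrow> f ` V \<in> bases M\<^sub>1" if V: "V \<subseteq> R" for V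
    proof (cases "V \<union> P \<in> merged_bases")
      case True
      then show ?thesis using iff[OF V] by (auto simp: merged_bases_def)
    next
      case False
      show ?thesis
      proof (cases "card V = rank M\<^sub>1")
        case True
        have "V \<union> P \<in> nonamplified M\<^sub>2 A\<^sub>2 B\<^sub>2"
          using close_nonbases(2)[OF sub[OF Z] non sub[OF V True] False close[OF Z] 1] .
        then show ?thesis using iff[OF V] False by (auto simp: nonamplified_def)
      next
        case False
        then show ?thesis
          using cardU[OF V] cardf[OF V] cardP k2 by (auto simp: amplified_def M1.bases_iff)
      qed
    qed
    obtain L where L: "obtainable M\<^sub>2 L" "matroid L" "ground L = E" "bases L = amplified M\<^sub>2 A\<^sub>2 B\<^sub>2"
      using ex_amplified2 by auto
    obtain B0 where B0: "B0 \<in> bases M\<^sub>1" by (rule M1.basis_exists)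
    then obtain Z0 where Z0: "Z0 \<subseteq> R" "B0 = f ` Z0"
      using M1.basis_subset[OF B0] imf by (metis subset_image_iff)
    then obtain N where N: "is_minor N L" "matroid N" "ground N = R"
      "bases N = {Z. Z \<subseteq> R \<and> Z \<union> P \<in> bases L}"
      using matroid.minor_exists[OF L(2), of P R Z0] iff2[of Z0] PR B0 L(3,4) by auto
    have "isomorphic N M\<^sub>1"
      using N L iff2 f M1 by (intro isomorphicI[where f = f]) auto
    then show False using obtainable.minor[OF L(1) N(1)] not_obtainable1 by blast
  next
    case 2
    \<comment> \<open>All nonbases of the minor come from the same removed set, so
      \<open>M\<^sub>1\<close> has a unique nonbasis.\<close>
    have "f ` Z \<in> nonbases M\<^sub>1"
      using nbZ cardf[OF Z(1)] Z imf by (auto simp: nonbases_def M1.bases_iff)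
    moreover have "W = f ` Z" if W: "W \<in> nonbases M\<^sub>1" for W
    proof -
      obtain V where V: "V \<subseteq> R" "card V = rank M\<^sub>1" "W = f ` V" "V \<union> P \<notin> merged_bases"
        using nonbasis_preimage[OF W] by blast
      have "V \<union> P = Z \<union> P"
        using close_nonbases(3)[OF sub[OF Z] non sub[OF V(1,2)] V(4) close[OF Z] 2] .
      then have "V = Z" using V(1) Z(1) PR(3) by blast
      then show ?thesis using V(3) by simp
    qed
    ultimately have "f ` Z \<in> circuit_hyperplanes M\<^sub>1" using M1.unique_nonbasis pos1 by blast
    then show False using no_ch1 by simp
  qed
qed

text \<open>A copy of \<open>M\<^sub>1\<close> inside \<open>M'\<close> enlarges the contracted part
  \<open>P\<close> by some \<open>Q\<close> and possibly the deleted part. The bounds from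
  \<open>amplified_self_minor\<close> for the larger parts restrict to \<open>M'\<close>.\<close>

lemma minor_location1:
  assumes "matroid M'" "ground M' \<subseteq> E" "P \<subseteq> E - ground M'"
    and bases: "bases M' = {Z. Z \<subseteq> ground M' \<and> Z \<union> P \<in> merged_bases}"
    and "has_minor_iso M' M\<^sub>1"
  shows "P \<subseteq> A\<^sub>1 \<union> cofree_elements M\<^sub>1" "E - P - ground M' \<subseteq> B\<^sub>1 \<union> free_elements M\<^sub>1"
proof -
  interpret M': matroid M' by fact
  obtain N where N: "is_minor N M'" "isomorphic N M\<^sub>1" using assms(5) by (auto simp: has_minor_iso_def)
  note mN = M'.minor_bases[OF N(1)]
  obtain Q where Q: "Q \<subseteq> ground M' - ground N" "bases N = {Z. Z \<subseteq> ground N \<and> Z \<union> Q \<in> bases M'}"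
    using mN(3) by auto
  obtain f where f: "bij_betw f (ground N) (ground M\<^sub>1)"
    and ff: "\<And>Z. Z \<subseteq> ground N \<Longrightarrow> Z \<in> bases N \<longleftrightarrow> f ` Z \<in> bases M\<^sub>1"
    using isomorphic_bases[OF mN(1) M1 N(2)] by blast
  let ?P = "P \<union> Q"
  have PR: "?P \<subseteq> E" "ground N \<subseteq> E" "?P \<inter> ground N = {}" using assms(2,3) Q(1) mN(2) by auto
  have "Z \<union> ?P \<in> merged_bases \<longleftrightarrow> f ` Z \<in> bases M\<^sub>1" if "Z \<subseteq> ground N" for Z
  proof -
    have "Z \<union> Q \<subseteq> ground M'" using that mN(2) Q(1) by auto
    then have "Z \<union> Q \<in> bases M' \<longleftrightarrow> Z \<union> Q \<union> P \<in> merged_bases" by (simp add: bases)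
    moreover have "Z \<union> Q \<union> P = Z \<union> ?P" by auto
    ultimately show ?thesis using ff[OF that] Q(2) that by simp
  qed
  note amp = minor_is_amplified_minor1[OF PR f this]
  have "?P \<subseteq> A\<^sub>1 \<union> cofree_elements M\<^sub>1" "E - ?P - ground N \<subseteq> B\<^sub>1 \<union> free_elements M\<^sub>1"
    using M1.amplified_self_minor[OF fin1 dis1 _ _ PR(3) f amp nonuniform1] PR unfolding E1 by blast+
  then show "P \<subseteq> A\<^sub>1 \<union> cofree_elements M\<^sub>1" "E - P - ground M' \<subseteq> B\<^sub>1 \<union> free_elements M\<^sub>1"
    using Q(1) mN(2) by auto
qed

text \<open>An element lost in a proper minor with both copies would be contracted for both or
  deleted for both; the placement of the free elements excludes either.\<close>

lemma intertwine_merged: "intertwine (spread E merged_bases) M\<^sub>1 M\<^sub>2"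
proof -
  interpret swapped: merge M\<^sub>2 M\<^sub>1 A\<^sub>2 B\<^sub>2 A\<^sub>1 B\<^sub>1 E \<H> k d by (rule swap)
  have eq: "swapped.merged_bases = merged_bases"
    by (auto simp: merged_bases_def swapped.merged_bases_def)
  interpret M: matroid "spread E merged_bases" by (rule matroid_merged)
  have "\<not> (has_minor_iso M' M\<^sub>1 \<and> has_minor_iso M' M\<^sub>2)" if M': "is_proper_minor M' (spread E merged_bases)" for M'
  proof
    assume both: "has_minor_iso M' M\<^sub>1 \<and> has_minor_iso M' M\<^sub>2"
    have minor: "is_minor M' (spread E merged_bases)" and ne: "ground M' \<noteq> E"
      using M' by (auto simp: is_proper_minor_def)
    note mM = M.minor_bases[OF minor, simplified]
    obtain P where P: "P \<subseteq> E - ground M'" "bases M' = {Z. Z \<subseteq> ground M' \<and> Z \<union> P \<in> merged_bases}"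
      using mM(3) by (auto simp: bases_merged)
    note loc1 = minor_location1[OF mM(1,2) P] and loc2 = swapped.minor_location1[OF mM(1,2) P[folded eq]]
    obtain e where e: "e \<in> E" "e \<notin> ground M'" using mM(2) ne by blast
    have fc1: "free_elements M\<^sub>1 \<inter> cofree_elements M\<^sub>1 = {}" by (rule M1.free_cofree_disjoint[OF nonuniform1])
    have fc2: "free_elements M\<^sub>2 \<inter> cofree_elements M\<^sub>2 = {}" by (rule M2.free_cofree_disjoint[OF swapped.nonuniform1])
    have c: "cofree_elements M\<^sub>1 \<subseteq> ground M\<^sub>1" "cofree_elements M\<^sub>2 \<subseteq> ground M\<^sub>2"
      "free_elements M\<^sub>1 \<subseteq> ground M\<^sub>1" "free_elements M\<^sub>2 \<subseteq> ground M\<^sub>2"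
      by (auto simp: cofree_elements_def free_elements_def)
    show False
    proof (cases "e \<in> P")
      case True
      \<comment> \<open>\<open>A\<^sub>2\<close> meets the ground set of \<open>M\<^sub>1\<close> in
        its free elements only, none of which is cofree, and symmetrically.\<close>
      then have "e \<in> A\<^sub>1 \<union> cofree_elements M\<^sub>1" "e \<in> A\<^sub>2 \<union> cofree_elements M\<^sub>2"
        using loc1(1) loc2(1) both by auto
      then show False using AA free1 free2 fc1 fc2 c disjoint_grounds by blast
    next
      case False
      \<comment> \<open>The free elements of \<open>M\<^sub>1\<close> lie in
        \<open>A\<^sub>2\<close> and thus outside \<open>B\<^sub>2\<close>, and
        symmetrically.\<close>
      then have "e \<in> B\<^sub>1 \<union> free_elements M\<^sub>1" "e \<in> B\<^sub>2 \<union> free_elements M\<^sub>2"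
        using loc1(2) loc2(2) both e by blast+
      then show False using BB free1 free2 dis1 dis2 c disjoint_grounds by blast
    qed
  qed
  then show ?thesis
    using matroid_merged has_minor1 swapped.has_minor1 unfolding intertwine_def eq by blast
qed

end

section \<open>Constructing many intertwines\<close>

text \<open>Failing the amplified inequality leaves room for few elements of \<open>B\<close>; as
  the size is fixed, almost all of \<open>A\<close> must then be present. This yields the distances
  needed for merging.\<close>

lemma (in matroid) nonamplified_bounds:
  assumes X: "X \<in> nonamplified M A B" and fin: "finite A" "finite B"
    and dis: "A \<inter> ground M = {}" "B \<inter> (ground M \<union> A) = {}"
  shows "card (X \<inter> B) < rank M" "card (A - X) \<le> card (ground M)"
proof -
  have Xs: "X \<subseteq> ground M \<union> A \<union> B" "card X = rank M + card A" "X \<notin> amplified M A B"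
    using X by (auto simp: nonamplified_def)
  then have finX: "finite X" using fin finite_ground by (auto intro: finite_subset)
  show lt: "card (X \<inter> B) < rank M" using Xs by (auto simp: amplified_def)
  have "card X = card (X \<inter> ground M) + card (X \<inter> A) + card (X \<inter> B)"
    using finX Xs dis by (intro card_partition3) auto
  moreover have "card A = card (X \<inter> A) + card (A - X)"
    using card_Int_Diff[OF fin(1), of X] by (simp add: Int_commute)
  moreover have "card (X \<inter> ground M) \<le> card (ground M)" using finite_ground by (intro card_mono) auto
  ultimately show "card (A - X) \<le> card (ground M)" using Xs lt by linarith
qed

text \<open>The invariant that tells the constructed intertwines apart.\<close>

lemma isomorphic_card_bases:
  assumes "matroid M" "matroid N" "isomorphic M N"
  shows "card (bases M) = card (bases N)"
proof -
  interpret M: matroid M by fact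
  interpret N: matroid N by fact
  obtain f where f: "bij_betw f (ground M) (ground N)"
    "\<And>Z. Z \<subseteq> ground M \<Longrightarrow> Z \<in> bases M \<longleftrightarrow> f ` Z \<in> bases N"
    using isomorphic_bases[OF assms] by blast
  have "(`) f ` bases M = bases N"
  proof (intro set_eqI iffI)
    fix B assume "B \<in> (`) f ` bases M"
    then show "B \<in> bases N" using f(2) M.basis_subset by auto
  next
    fix B assume B: "B \<in> bases N"
    then have "B \<subseteq> f ` ground M" using N.basis_subset f(1) by (simp add: bij_betw_def)
    then obtain Z where "Z \<subseteq> ground M" "B = f ` Z" by (auto simp: subset_image_iff)
    then show "B \<in> (`) f ` bases M" using B f(2) by auto
  qed
  moreover have "inj_on ((`) f) (bases M)"
    using inj_on_image_Pow[of f "ground M"] f(1) M.basis_subset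
    by (auto simp: bij_betw_def intro: inj_on_subset)
  ultimately show ?thesis by (metis card_image)
qed

lemma isomorphic_refl: "isomorphic M M"
  unfolding isomorphic_def by (intro exI[of _ id]) auto

lemma ex_disjoint_blocks:
  assumes "finite U" "n * c \<le> card U"
  obtains Y :: "nat \<Rightarrow> 'a set" where "\<forall>i<n. Y i \<subseteq> U \<and> card (Y i) = c"
    "\<forall>i<n. \<forall>j<n. i \<noteq> j \<longrightarrow> Y i \<inter> Y j = {}"
proof -
  obtain u where u: "bij_betw u {0..<card U} U" using ex_bij_betw_nat_finite assms(1) by blast
  define J where "J i = {i * c..<i * c + c}" for i
  have J: "J i \<subseteq> {0..<card U}" if "i < n" for i
  proof -
    have "Suc i * c \<le> n * c" using that by (intro mult_le_mono1) auto
    then show ?thesis using assms(2) by (auto simp: J_def)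
  qed
  have dis: "J i \<inter> J j = {}" if "i < j" for i j
  proof -
    have "Suc i * c \<le> j * c" using that by (intro mult_le_mono1) auto
    then show ?thesis by (auto simp: J_def)
  qed
  then have dis: "J i \<inter> J j = {}" if "i \<noteq> j" for i j using that by (metis Int_commute linorder_neqE_nat)
  have inj: "inj_on u {0..<card U}" and im: "u ` {0..<card U} = U" using u by (auto simp: bij_betw_def)
  show ?thesis
  proof (rule that[of "\<lambda>i. u ` J i"]; intro allI impI)
    show "u ` J i \<subseteq> U \<and> card (u ` J i) = c" if "i < n" for i
      using J[OF that] im card_image[OF inj_on_subset[OF inj J[OF that]]] by (auto simp: J_def)
    show "u ` J i \<inter> u ` J j = {}" if "i < n" "j < n" "i \<noteq> j" for i j
      using inj_on_image_Int[OF inj J[OF that(1)] J[OF that(2)]] dis[OF that(3)] by simp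
  qed
qed

theorem theorem3p5:
  fixes M\<^sub>1 M\<^sub>2 :: "'a :: infinite indep_system"
  assumes "matroid M\<^sub>1" and "matroid M\<^sub>2"
    and "rank M\<^sub>1 > 0" and "rank M\<^sub>2 > 0"
    and "ground M\<^sub>1 \<inter> ground M\<^sub>2 = {}"
    and "\<not> (\<exists>N. obtainable M\<^sub>2 N \<and> isomorphic N M\<^sub>1)"
    and "\<not> (\<exists>N. obtainable M\<^sub>1 N \<and> isomorphic N M\<^sub>2)"
    and "circuit_hyperplanes M\<^sub>1 = {}" and "circuit_hyperplanes M\<^sub>2 = {}"
  shows "\<forall>n::nat. \<exists>k\<^sub>0::nat. \<forall>k\<ge>k\<^sub>0. \<exists>S :: 'a indep_system set.
           finite S \<and> card S \<ge> n \<and>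
           (\<forall>M\<in>S. intertwine M M\<^sub>1 M\<^sub>2 \<and> rank M = k) \<and>
           pairwise (\<lambda>M N. \<not> isomorphic M N) S"
proof
  fix n :: nat
  interpret M1: matroid M\<^sub>1 by fact
  interpret M2: matroid M\<^sub>2 by fact
  define t where "t = card (ground M\<^sub>1) + card (ground M\<^sub>2)"
  \<comment> \<open>\<open>d\<close> bounds both ranks, and the block size \<open>c\<close> exceeds
    \<open>d + t\<close>, so a block remains larger than \<open>d\<close> after losing the at most
    \<open>t\<close> elements it may share with a nonbasis.\<close>
  define d where "d = t + 1"
  define c where "c = 2 * t + 2"
  let ?F\<^sub>1 = "free_elements M\<^sub>1" and ?F\<^sub>2 = "free_elements M\<^sub>2"
  have Fsub: "?F\<^sub>1 \<subseteq> ground M\<^sub>1" "?F\<^sub>2 \<subseteq> ground M\<^sub>2" by (auto simp: free_elements_def)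
  then have finF: "finite ?F\<^sub>1" "finite ?F\<^sub>2" using M1.finite_ground M2.finite_ground finite_subset by auto
  have small: "rank M\<^sub>1 \<le> card (ground M\<^sub>1)" "rank M\<^sub>2 \<le> card (ground M\<^sub>2)"
    "card ?F\<^sub>1 \<le> card (ground M\<^sub>1)" "card ?F\<^sub>2 \<le> card (ground M\<^sub>2)"
    using M1.rank_of_le_card[OF M1.finite_ground] M2.rank_of_le_card[OF M2.finite_ground]
      card_mono[OF M1.finite_ground Fsub(1)] card_mono[OF M2.finite_ground Fsub(2)]
    by (auto simp: rank_def)
  have "\<exists>S :: 'a indep_system set. finite S \<and> card S \<ge> n \<and>
      (\<forall>M\<in>S. intertwine M M\<^sub>1 M\<^sub>2 \<and> rank M = k) \<and> pairwise (\<lambda>M N. \<not> isomorphic M N) S"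
    \<comment> \<open>The term \<open>n * c\<close> gives room for \<open>n\<close> disjoint blocks
      in \<open>U\<close>; the rest is slack for the distance estimates.\<close>
    if k: "n * c + 6 * t + 6 \<le> k" for k
  proof -
    have "finite (ground M\<^sub>1 \<union> ground M\<^sub>2)" using M1.finite_ground M2.finite_ground by simp
    \<comment> \<open>\<open>U\<close> is to be contracted for \<open>M\<^sub>1\<close> together
      with the free elements of \<open>M\<^sub>2\<close>, so its size makes the rank equal to
      \<open>k\<close>. The subtractions are not cut off at zero, since \<open>k\<close> is
      large.\<close>
    then obtain U where U: "finite U" "card U = k - rank M\<^sub>1 - card ?F\<^sub>2" "U \<inter> (ground M\<^sub>1 \<union> ground M\<^sub>2) = {}"
      by (rule ex_fresh_subset)
    have "finite (ground M\<^sub>1 \<union> ground M\<^sub>2 \<union> U)" using U M1.finite_ground M2.finite_ground by simp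
    then obtain V where V: "finite V" "card V = k - rank M\<^sub>2 - card ?F\<^sub>1" "V \<inter> (ground M\<^sub>1 \<union> ground M\<^sub>2 \<union> U) = {}"
      by (rule ex_fresh_subset)
    have cU: "k - t \<le> card U" and cV: "k - t \<le> card V" using U V small by (auto simp: t_def)
    have "n * c \<le> card U" using cU k by simp
    with U(1) obtain Y where "\<forall>i<n. Y i \<subseteq> U \<and> card (Y i) = c"
      "\<forall>i<n. \<forall>j<n. i \<noteq> j \<longrightarrow> Y i \<inter> Y j = {}"
      by (rule ex_disjoint_blocks)
    then have Y: "\<And>i. i < n \<Longrightarrow> Y i \<subseteq> U" "\<And>i. i < n \<Longrightarrow> card (Y i) = c"
      "\<And>i j. i < n \<Longrightarrow> j < n \<Longrightarrow> i \<noteq> j \<Longrightarrow> Y i \<inter> Y j = {}" by blast+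
    have "k - c \<le> card V" using cV by (simp add: c_def)
    then obtain K where K: "K \<subseteq> V" "card K = k - c" by (meson obtain_subset_with_card_n)
    \<comment> \<open>The fresh sets play opposite roles for the two matroids: \<open>U\<close> is
      contracted for \<open>M\<^sub>1\<close> and deleted for \<open>M\<^sub>2\<close>, and
      \<open>V\<close> the other way round.\<close>
    define A\<^sub>1 B\<^sub>1 A\<^sub>2 B\<^sub>2 E where "A\<^sub>1 = U \<union> ?F\<^sub>2" and "B\<^sub>1 = V \<union> (ground M\<^sub>2 - ?F\<^sub>2)"
      and "A\<^sub>2 = V \<union> ?F\<^sub>1" and "B\<^sub>2 = U \<union> (ground M\<^sub>1 - ?F\<^sub>1)"
      and "E = ground M\<^sub>1 \<union> ground M\<^sub>2 \<union> U \<union> V"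
    note defs = A\<^sub>1_def B\<^sub>1_def A\<^sub>2_def B\<^sub>2_def E_def
    have fin1: "finite A\<^sub>1" "finite B\<^sub>1" and fin2: "finite A\<^sub>2" "finite B\<^sub>2" and finE: "finite E"
      using U V finF M1.finite_ground M2.finite_ground by (auto simp: defs)
    have dis1: "A\<^sub>1 \<inter> ground M\<^sub>1 = {}" "B\<^sub>1 \<inter> (ground M\<^sub>1 \<union> A\<^sub>1) = {}"
      and dis2: "A\<^sub>2 \<inter> ground M\<^sub>2 = {}" "B\<^sub>2 \<inter> (ground M\<^sub>2 \<union> A\<^sub>2) = {}"
      and AB: "A\<^sub>1 \<inter> A\<^sub>2 = {}" "B\<^sub>1 \<inter> B\<^sub>2 = {}"
      and AF: "A\<^sub>2 \<inter> ground M\<^sub>1 = ?F\<^sub>1" "A\<^sub>1 \<inter> ground M\<^sub>2 = ?F\<^sub>2"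
      using U(3) V(3) Fsub assms(5) unfolding defs by blast+
    have E: "E = ground M\<^sub>1 \<union> A\<^sub>1 \<union> B\<^sub>1" "E = ground M\<^sub>2 \<union> A\<^sub>2 \<union> B\<^sub>2"
      using Fsub unfolding defs by blast+
    have "card A\<^sub>1 = card U + card ?F\<^sub>2" "card A\<^sub>2 = card V + card ?F\<^sub>1"
      unfolding defs using U(1,3) V(1,3) finF Fsub by (intro card_Un_disjoint; blast)+
    then have kA: "k = rank M\<^sub>1 + card A\<^sub>1" "k = rank M\<^sub>2 + card A\<^sub>2"
      using U V k small by (auto simp: t_def)
    have non1: "card (X \<inter> V) \<le> t" "card (U - X) \<le> card (ground M\<^sub>1)" "finite X" "X \<subseteq> E" "card X = k"
      if X: "X \<in> nonamplified M\<^sub>1 A\<^sub>1 B\<^sub>1" for X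
    proof -
      show X': "X \<subseteq> E" "card X = k" using X E kA by (auto simp: nonamplified_def)
      show fX: "finite X" using X' finE finite_subset by auto
      note b = M1.nonamplified_bounds[OF X fin1 dis1]
      have "card (X \<inter> V) \<le> card (X \<inter> B\<^sub>1)" using fX by (intro card_mono) (auto simp: defs)
      then show "card (X \<inter> V) \<le> t" using b small by (simp add: t_def)
      have "card (U - X) \<le> card (A\<^sub>1 - X)" using fin1 by (intro card_mono) (auto simp: defs)
      then show "card (U - X) \<le> card (ground M\<^sub>1)" using b by simp
    qed
    have non2: "card (X \<inter> U) \<le> card (ground M\<^sub>2)" "finite X" "X \<subseteq> E" "card X = k"
      if X: "X \<in> nonamplified M\<^sub>2 A\<^sub>2 B\<^sub>2" for X
    proof -
      show X': "X \<subseteq> E" "card X = k" using X E kA by (auto simp: nonamplified_def)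
      show fX: "finite X" using X' finE finite_subset by auto
      note b = M2.nonamplified_bounds[OF X fin2 dis2]
      have "card (X \<inter> U) \<le> card (X \<inter> B\<^sub>2)" using fX by (intro card_mono) (auto simp: defs)
      then show "card (X \<inter> U) \<le> card (ground M\<^sub>2)" using b small by simp
    qed
    have far: "d < card (X - Z)"
      if X: "X \<in> nonamplified M\<^sub>1 A\<^sub>1 B\<^sub>1" and Z: "Z \<in> nonamplified M\<^sub>2 A\<^sub>2 B\<^sub>2" for X Z
    proof -
      have "U \<subseteq> (U - X) \<union> (X - Z) \<union> (Z \<inter> U)" by auto
      then have "card U \<le> card ((U - X) \<union> (X - Z) \<union> (Z \<inter> U))"
        using U non1[OF X] non2[OF Z] by (intro card_mono) auto
      also have "\<dots> \<le> card (U - X) + card (X - Z) + card (Z \<inter> U)"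
        by (meson card_Un_le add_le_mono1 order_trans)
      finally show ?thesis using cU k non1[OF X] non2[OF Z] by (simp add: d_def t_def)
    qed
    \<comment> \<open>Nonbases of the first kind contain few elements of \<open>V\<close>, so the
      large common part \<open>K\<close> keeps \<open>H i\<close> far from them. Those of the second
      kind contain few elements of \<open>U\<close>, so the block \<open>Y i\<close> does the same;
      disjoint blocks separate the sets \<open>H i\<close> from each other.\<close>
    define H where "H i = Y i \<union> K" for i
    have finYK: "finite (Y i)" "finite K" if "i < n" for i
      using Y(1)[OF that] K U V finite_subset by auto
    have YK: "Y i \<inter> K = {}" if "i < n" for i using Y(1)[OF that] K V(3) by blast
    have ck: "c < k" using k by (simp add: c_def)
    have H: "H i \<subseteq> E \<and> card (H i) = k" if "i < n" for i
    proof -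
      have "card (H i) = k"
        unfolding H_def using card_Un_disjoint[OF finYK[OF that] YK[OF that]] Y(2)[OF that] K ck by simp
      then show ?thesis using Y(1)[OF that] K by (auto simp: H_def E_def)
    qed
    have far1: "d < card (H i - X)" if i: "i < n" and X: "X \<in> nonamplified M\<^sub>1 A\<^sub>1 B\<^sub>1" for i X
    proof -
      have "K \<subseteq> (H i - X) \<union> (X \<inter> V)" using K by (auto simp: H_def)
      then have "card K \<le> card ((H i - X) \<union> (X \<inter> V))"
        using finYK[OF i] non1[OF X] by (intro card_mono) (auto simp: H_def)
      also have "\<dots> \<le> card (H i - X) + card (X \<inter> V)" by (rule card_Un_le)
      finally show ?thesis using K k non1[OF X] by (simp add: d_def c_def)
    qed
    have far2: "d < card (H i - X)" if i: "i < n" and X: "X \<in> nonamplified M\<^sub>2 A\<^sub>2 B\<^sub>2" for i X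
    proof -
      have "Y i \<subseteq> (H i - X) \<union> (X \<inter> U)" using Y(1)[OF i] by (auto simp: H_def)
      then have "card (Y i) \<le> card ((H i - X) \<union> (X \<inter> U))"
        using finYK[OF i] non2[OF X] by (intro card_mono) (auto simp: H_def)
      also have "\<dots> \<le> card (H i - X) + card (X \<inter> U)" by (rule card_Un_le)
      finally show ?thesis using Y(2)[OF i] non2[OF X] by (simp add: d_def c_def t_def)
    qed
    have farH: "d < card (H i - H j)" if "i < n" "j < n" "i \<noteq> j" for i j
    proof -
      have "Y i \<subseteq> H i - H j" using Y(3)[OF that] YK[OF that(1)] by (auto simp: H_def)
      then have "card (Y i) \<le> card (H i - H j)" using finYK[OF that(1)] by (intro card_mono) (auto simp: H_def)
      then show ?thesis using Y(2)[OF that(1)] by (simp add: d_def c_def)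
    qed
    have injH: "inj_on H {..<n}"
    proof (rule inj_onI)
      fix i j assume "i \<in> {..<n}" "j \<in> {..<n}" "H i = H j"
      then show "i = j" using farH[of i j] by auto
    qed
    \<comment> \<open>Each \<open>H i\<close> meets both \<open>U\<close> and \<open>V\<close>,
      whereas \<open>Z \<union> A\<^sub>1\<close> misses \<open>V\<close> and
      \<open>Z \<union> A\<^sub>2\<close> misses \<open>U\<close>. So the sets that yield the two
      minors are never removed.\<close>
    have H_avoids: "H i \<inter> V \<noteq> {}" "H i \<inter> U \<noteq> {}" if "i < n" for i
    proof -
      have "K \<noteq> {}" "Y i \<noteq> {}" using K ck Y(2)[OF that] by (auto simp: c_def)
      then show "H i \<inter> V \<noteq> {}" "H i \<inter> U \<noteq> {}" using K(1) Y(1)[OF that] by (auto simp: H_def)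
    qed
    \<comment> \<open>\<open>U\<close> lies in \<open>A\<^sub>1\<close> and in
      \<open>B\<^sub>2\<close>, so the count in \<open>B\<^sub>2\<close> alone reaches
      \<open>rank M\<^sub>2\<close>.\<close>
    have core1: "Z \<union> A\<^sub>1 \<in> amplified M\<^sub>2 A\<^sub>2 B\<^sub>2" if Z: "Z \<subseteq> ground M\<^sub>1" "card Z = rank M\<^sub>1" for Z
    proof -
      have "card (Z \<union> A\<^sub>1) = k"
        using card_Un_disjoint[of Z A\<^sub>1] finite_subset[OF Z(1) M1.finite_ground] fin1 dis1 Z kA by auto
      moreover have "card U \<le> card ((Z \<union> A\<^sub>1) \<inter> B\<^sub>2)" using fin2 by (intro card_mono) (auto simp: defs)
      moreover have "rank M\<^sub>2 \<le> card U" using cU k small by (simp add: t_def)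
      moreover have "Z \<union> A\<^sub>1 \<subseteq> ground M\<^sub>2 \<union> A\<^sub>2 \<union> B\<^sub>2" using Z E by auto
      ultimately show ?thesis using kA by (auto simp: amplified_def)
    qed
    have core2: "Z \<union> A\<^sub>2 \<in> amplified M\<^sub>1 A\<^sub>1 B\<^sub>1" if Z: "Z \<subseteq> ground M\<^sub>2" "card Z = rank M\<^sub>2" for Z
    proof -
      have "card (Z \<union> A\<^sub>2) = k"
        using card_Un_disjoint[of Z A\<^sub>2] finite_subset[OF Z(1) M2.finite_ground] fin2 dis2 Z kA by auto
      moreover have "card V \<le> card ((Z \<union> A\<^sub>2) \<inter> B\<^sub>1)" using fin1 by (intro card_mono) (auto simp: defs)
      moreover have "rank M\<^sub>1 \<le> card V" using cV k small by (simp add: t_def)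
      moreover have "Z \<union> A\<^sub>2 \<subseteq> ground M\<^sub>1 \<union> A\<^sub>1 \<union> B\<^sub>1" using Z E by auto
      ultimately show ?thesis using kA by (auto simp: amplified_def)
    qed
    have not_H1: "Z \<union> A\<^sub>1 \<noteq> H i" if "i < n" "Z \<subseteq> ground M\<^sub>1" for Z i
    proof -
      have "(Z \<union> A\<^sub>1) \<inter> V = {}" using that(2) V(3) Fsub by (auto simp: defs)
      then show ?thesis using H_avoids[OF that(1)] by auto
    qed
    have not_H2: "Z \<union> A\<^sub>2 \<noteq> H i" if "i < n" "Z \<subseteq> ground M\<^sub>2" for Z i
    proof -
      have "(Z \<union> A\<^sub>2) \<inter> U = {}" using that(2) U(3) V(3) Fsub by (auto simp: defs)
      then show ?thesis using H_avoids[OF that(1)] by auto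
    qed
    define D where "D = amplified M\<^sub>1 A\<^sub>1 B\<^sub>1 \<inter> amplified M\<^sub>2 A\<^sub>2 B\<^sub>2"
    \<comment> \<open>The family of candidates: the \<open>j\<close>-th matroid has the first
      \<open>j\<close> sets turned into nonbases.\<close>
    define L where "L j = spread E (D - H ` {..<j})" for j
    have L: "matroid (L j)" "bases (L j) = D - H ` {..<j}" "intertwine (L j) M\<^sub>1 M\<^sub>2" "rank (L j) = k"
      if j: "j < n" for j
    proof -
      have nj: "i < n" if "i < j" for i using that j by simp
      have "merge M\<^sub>1 M\<^sub>2 A\<^sub>1 B\<^sub>1 A\<^sub>2 B\<^sub>2 E (H ` {..<j}) k d"
      proof
        show "rank M\<^sub>1 \<le> d" "rank M\<^sub>2 \<le> d" using small by (auto simp: d_def t_def)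
        show "X \<subseteq> E \<and> card X = k" if "X \<in> H ` {..<j}" for X using that H nj by auto
        show "d < card (X - Z)" if "X \<in> H ` {..<j}" "Z \<in> nonamplified M\<^sub>1 A\<^sub>1 B\<^sub>1" for X Z
          using that far1 nj by auto
        show "d < card (X - Z)" if "X \<in> H ` {..<j}" "Z \<in> nonamplified M\<^sub>2 A\<^sub>2 B\<^sub>2" for X Z
          using that far2 nj by auto
        show "d < card (X - Z)" if "X \<in> H ` {..<j}" "Z \<in> H ` {..<j}" "X \<noteq> Z" for X Z
          using that farH nj by auto
        show "Z \<union> A\<^sub>1 \<in> amplified M\<^sub>2 A\<^sub>2 B\<^sub>2 - H ` {..<j}" if "Z \<subseteq> ground M\<^sub>1" "card Z = rank M\<^sub>1" for Z
          using that core1 not_H1 nj by auto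
        show "Z \<union> A\<^sub>2 \<in> amplified M\<^sub>1 A\<^sub>1 B\<^sub>1 - H ` {..<j}" if "Z \<subseteq> ground M\<^sub>2" "card Z = rank M\<^sub>2" for Z
          using that core2 not_H2 nj by auto
      qed (fact assms fin1 fin2 dis1 dis2 E kA AB AF far)+
      then interpret merge M\<^sub>1 M\<^sub>2 A\<^sub>1 B\<^sub>1 A\<^sub>2 B\<^sub>2 E "H ` {..<j}" k d .
      have L: "L j = spread E merged_bases" by (simp add: L_def merged_bases_def D_def)
      show "matroid (L j)" "bases (L j) = D - H ` {..<j}" "intertwine (L j) M\<^sub>1 M\<^sub>2" "rank (L j) = k"
        unfolding L using matroid_merged intertwine_merged rank_merged bases_merged
        by (simp_all add: merged_bases_def D_def)
    qed
    \<comment> \<open>A set at distance more than \<open>d\<close> from every nonbasis cannot be one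
      itself. Hence each removal really lowers the number of bases.\<close>
    have HD: "H i \<in> D" if "i < n" for i
    proof -
      have "H i \<notin> nonamplified M\<^sub>1 A\<^sub>1 B\<^sub>1" "H i \<notin> nonamplified M\<^sub>2 A\<^sub>2 B\<^sub>2"
        using far1[OF that] far2[OF that] by fastforce+
      then show ?thesis using H[OF that] E kA by (auto simp: nonamplified_def D_def)
    qed
    have finD: "finite D"
      by (rule finite_subset[of _ "Pow E"]) (use finE E in \<open>auto simp: D_def amplified_def\<close>)
    have cardL: "card (bases (L j)) + j = card D" if j: "j < n" for j
    proof -
      have sub: "H ` {..<j} \<subseteq> D" using HD j by auto
      have "card (H ` {..<j}) = j" using j inj_on_subset[OF injH, of "{..<j}"] by (simp add: card_image)
      then show ?thesis
        using card_Diff_subset[OF _ sub] card_mono[OF finD sub] by (simp add: L(2)[OF j])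
    qed
    have noniso: "i = j" if "i < n" "j < n" "isomorphic (L i) (L j)" for i j
      using isomorphic_card_bases[OF L(1)[OF that(1)] L(1)[OF that(2)] that(3)]
        cardL[OF that(1)] cardL[OF that(2)] by simp
    have "inj_on L {..<n}"
      using noniso isomorphic_refl by (metis inj_onI lessThan_iff)
    then have "card (L ` {..<n}) = n" by (simp add: card_image)
    moreover have "pairwise (\<lambda>M N. \<not> isomorphic M N) (L ` {..<n})"
      using noniso by (auto simp: pairwise_def)
    ultimately show ?thesis
      using L by (intro exI[of _ "L ` {..<n}"]) auto
  qed
  then show "\<exists>k\<^sub>0. \<forall>k\<ge>k\<^sub>0. \<exists>S :: 'a indep_system set. finite S \<and> card S \<ge> n \<and>
      (\<forall>M\<in>S. intertwine M M\<^sub>1 M\<^sub>2 \<and> rank M = k) \<and> pairwise (\<lambda>M N. \<not> isomorphic M N) S"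
    by blast
qed

end
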